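(* Let $\boldsymbol{\lambda}=\{\lambda_n\}_{n=0}^\infty$ be a decreasing sequence of positive real numbers. Then the following conditions are equivalent. (i) The Hankel type operator $\mathcal{H}_{\boldsymbol{\lambda}}$ is compact on the Dirichlet space $\mathcal{D}$. (ii) $\lim_{t\to1^-}\|\mathcal{H}_{\boldsymbol{\lambda}}k_t\|_{\mathcal{D}}=0$, where $k_t$ is the normalized reproducing kernel of $\mathcal{D}$ at $t\in[0,1)$. (iii) $\displaystyle\sum_{n=m}^\infty n\lambda_n^2=o\left(\frac{1}{\log(m+2)}\right)$ as $m\to\infty$.
   Context: $\mathbb{D}$ is the open unit disk, $H(\mathbb{D})$ is the space of analytic functions on $\mathbb{D}$, and $dA=\pi^{-1}dx\,dy$ is normalized Lebesgue measure on $\mathbb{D}$. "Decreasing" is understood in the non-strict sense: $\lambda_{n+1}\le\lambda_n$ for all $n$. The Dirichlet space $\mathcal{D}$ is the Hilbert space of $f\in H(\mathbb{D})$ with $\|f\|_{\mathcal{D}}^2=|f(0)|^2+\int_{\mathbb{D}}|f'(z)|^2dA(z)<\infty$. Its reproducing kernel at $w\in\mathbb{D}$ is $K_w(z)=1+\log\frac{1}{1-z\overline{w}}$, and the normalized reproducing kernel is $k_w(z)=K_w(z)/\sqrt{K_w(w)}$. For $f(z)=\sum_{k\ge0}a_kz^k\in H(\mathbb{D})$, the Hankel type operator is $\mathcal{H}_{\boldsymbol{\lambda}}(f)(z)=\sum_{n=0}^\infty\left(\sum_{k=0}^\infty\lambda_{n+k}a_k\right)z^n$, whenever the right-hand side makes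 sense and defines an analytic function in $\mathbb{D}$. It is compact on $\mathcal{D}$ if $\mathcal{H}_{\boldsymbol{\lambda}}(f)$ is well defined for every $f\in\mathcal{D}$ and $\mathcal{H}_{\boldsymbol{\lambda}}$ is a compact linear operator from $\mathcal{D}$ to $\mathcal{D}$. The norm $\|\cdot\|_{\mathcal{D}}$ is understood to be $+\infty$ for a function not in $\mathcal{D}$. *)

theory Defs
  imports "HOL-Complex_Analysis.Complex_Analysis" "HOL-Library.Landau_Symbols"
begin

abbreviation unit_disk :: "complex set" where
  "unit_disk \<equiv> ball 0 1"

definition disk_area :: "complex measure" where
  "disk_area = scale_measure (ennreal (1 / pi)) (restrict_space lborel unit_disk)"

text \<open>
  Functions on the disk are represented by functions on the whole complex plane whose
  values outside the disk are irrelevant.  Squared norms and norms are extended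
  nonnegative, so that they are defined for every function.
\<close>

definition dirichlet_sqnorm :: "(complex \<Rightarrow> complex) \<Rightarrow> ennreal" where
  "dirichlet_sqnorm f =
     ennreal ((cmod (f 0))\<^sup>2) + (\<integral>\<^sup>+ z. ennreal ((cmod (deriv f z))\<^sup>2) \<partial>disk_area)"

definition dirichlet_space :: "(complex \<Rightarrow> complex) set" where
  "dirichlet_space = {f. f holomorphic_on unit_disk \<and> dirichlet_sqnorm f < \<infinity>}"

definition dirichlet_norm :: "(complex \<Rightarrow> complex) \<Rightarrow> ennreal" where
  "dirichlet_norm f =
     (if f \<in> dirichlet_space then ennreal (sqrt (enn2real (dirichlet_sqnorm f))) else \<infinity>)"

definition dirichlet_kernel :: "complex \<Rightarrow> complex \<Rightarrow> complex" where
  "dirichlet_kernel w z = 1 + Ln (1 / (1 - z * cnj w))"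

text \<open>For \<open>w\<close> in the disk, \<open>dirichlet_kernel w w\<close> is a real number \<open>\<ge> 1\<close>.\<close>

definition normalized_dirichlet_kernel :: "complex \<Rightarrow> complex \<Rightarrow> complex" where
  "normalized_dirichlet_kernel w z =
     dirichlet_kernel w z / complex_of_real (sqrt (Re (dirichlet_kernel w w)))"

definition taylor_coeff :: "(complex \<Rightarrow> complex) \<Rightarrow> nat \<Rightarrow> complex" where
  "taylor_coeff f k = (deriv ^^ k) f 0 / fact k"

definition hankel_coeff :: "(nat \<Rightarrow> real) \<Rightarrow> (complex \<Rightarrow> complex) \<Rightarrow> nat \<Rightarrow> complex" where
  "hankel_coeff lam f n = (\<Sum>k. complex_of_real (lam (n + k)) * taylor_coeff f k)"

definition hankel :: "(nat \<Rightarrow> real) \<Rightarrow> (complex \<Rightarrow> complex) \<Rightarrow> complex \<Rightarrow> complex" where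
  "hankel lam f z = (\<Sum>n. hankel_coeff lam f n * z ^ n)"

text \<open>
  \<^const>\<open>suminf\<close> has an unspecified value on divergent series, so \<^term>\<open>hankel lam f\<close>
  is meaningful only under the following condition.
\<close>

definition hankel_well_defined :: "(nat \<Rightarrow> real) \<Rightarrow> (complex \<Rightarrow> complex) \<Rightarrow> bool" where
  "hankel_well_defined lam f \<longleftrightarrow>
     (\<forall>n. summable (\<lambda>k. complex_of_real (lam (n + k)) * taylor_coeff f k)) \<and>
     (\<forall>z\<in>unit_disk. summable (\<lambda>n. hankel_coeff lam f n * z ^ n)) \<and>
     hankel lam f holomorphic_on unit_disk"

definition linear_on_dirichlet ::
    "((complex \<Rightarrow> complex) \<Rightarrow> complex \<Rightarrow> complex) \<Rightarrow> bool" where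
  "linear_on_dirichlet T \<longleftrightarrow>
     (\<forall>f\<in>dirichlet_space. T f \<in> dirichlet_space) \<and>
     (\<forall>f\<in>dirichlet_space. \<forall>g\<in>dirichlet_space. \<forall>z\<in>unit_disk.
        T (\<lambda>u. f u + g u) z = T f z + T g z) \<and>
     (\<forall>c. \<forall>f\<in>dirichlet_space. \<forall>z\<in>unit_disk. T (\<lambda>u. c * f u) z = c * T f z)"

text \<open>Compactness: the image of every bounded sequence has a norm-convergent subsequence.\<close>

definition compact_on_dirichlet ::
    "((complex \<Rightarrow> complex) \<Rightarrow> complex \<Rightarrow> complex) \<Rightarrow> bool" where
  "compact_on_dirichlet T \<longleftrightarrow>
     linear_on_dirichlet T \<and>
     (\<forall>F. (\<forall>n. F n \<in> dirichlet_space) \<and> (\<exists>C<\<infinity>. \<forall>n. dirichlet_norm (F n) \<le> C) \<longrightarrow>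
        (\<exists>g\<in>dirichlet_space. \<exists>r :: nat \<Rightarrow> nat. strict_mono r \<and>
           (\<lambda>n. dirichlet_norm (\<lambda>z. T (F (r n)) z - g z)) \<longlonglongrightarrow> 0))"

definition hankel_compact :: "(nat \<Rightarrow> real) \<Rightarrow> bool" where
  "hankel_compact lam \<longleftrightarrow>
     (\<forall>f\<in>dirichlet_space. hankel_well_defined lam f) \<and> compact_on_dirichlet (hankel lam)"

text \<open>
  For a nonnegative decreasing sequence the operator is always well defined on the
  normalized kernels, so their images may be used without a side condition.
\<close>

lemma hankel_well_defined_kernel:
  assumes dec: "decseq lam" and pos: "\<And>n. lam n \<ge> 0" and t: "0 \<le> t" "t < (1::real)"
  shows "hankel_well_defined lam (normalized_dirichlet_kernel (complex_of_real t))"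
proof -
  define f where "f = normalized_dirichlet_kernel (complex_of_real t)"
  define R where "R = 2 / (1 + t)"
  have R: "R > 1" using t by (simp add: R_def)
  have tR: "t * R < 1" using t by (simp add: R_def field_simps)
  have Re1: "Re (1 - z * complex_of_real t) > 0" if "z \<in> ball 0 R" for z
  proof -
    have "Re z * t \<le> cmod z * t" by (intro mult_right_mono complex_Re_le_cmod t)
    also have "\<dots> \<le> R * t" using that t by (intro mult_right_mono) auto
    finally show ?thesis using tR by (simp add: mult.commute)
  qed
  have nz: "1 - z * complex_of_real t \<noteq> 0" if "z \<in> ball 0 R" for z
    using Re1[OF that] by force
  have slit: "1 / (1 - z * complex_of_real t) \<notin> \<real>\<^sub>\<le>\<^sub>0" if "z \<in> ball 0 R" for z
    using Re1[OF that] nonpos_Reals_inverse_iff[of "1 - z * complex_of_real t"]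
    by (auto simp: complex_nonpos_Reals_iff inverse_eq_divide)
  have K: "dirichlet_kernel (complex_of_real t) holomorphic_on ball 0 R"
    unfolding dirichlet_kernel_def complex_cnj_complex_of_real
    by (intro holomorphic_intros) (use nz slit in auto)
  have f: "f holomorphic_on ball 0 R"
    unfolding f_def normalized_dirichlet_kernel_def divide_inverse
    by (intro holomorphic_on_mult K holomorphic_on_const)
  define x where "x = complex_of_real ((1 + R) / 2)"
  have x: "x \<in> ball 0 R" "cmod x > 1"
    using R by (auto simp: x_def simp del: of_real_divide of_real_add)
  have "(\<lambda>k. taylor_coeff f k * x ^ k) sums f x"
    using holomorphic_power_series[OF f x(1)] by (simp add: taylor_coeff_def)
  then have ps: "summable (\<lambda>k. taylor_coeff f k * x ^ k)"
    by (rule sums_summable)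
  have S: "summable (\<lambda>k. cmod (taylor_coeff f k))"
    using powser_insidea[OF ps, of 1] x(2) by simp
  have le: "cmod (complex_of_real (lam (n + k)) * taylor_coeff f k)
              \<le> lam 0 * cmod (taylor_coeff f k)" for n k
    using decseqD[OF dec, of 0 "n + k"] pos[of "n + k"] by (simp add: norm_mult mult_right_mono)
  have S0: "summable (\<lambda>k. lam 0 * cmod (taylor_coeff f k))"
    by (intro summable_mult S)
  have s1: "summable (\<lambda>k. complex_of_real (lam (n + k)) * taylor_coeff f k)" for n
    by (rule summable_comparison_test'[OF S0 le])
  define B where "B = (\<Sum>k. lam 0 * cmod (taylor_coeff f k))"
  have B: "cmod (hankel_coeff lam f n) \<le> B" for n
    unfolding hankel_coeff_def B_def by (rule norm_suminf_le[OF le S0])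
  have s2: "summable (\<lambda>n. hankel_coeff lam f n * z ^ n)" if "z \<in> unit_disk" for z
  proof (rule summable_comparison_test'[where N = 0])
    show "summable (\<lambda>n. B * cmod z ^ n)"
      using that by (intro summable_mult summable_geometric) auto
    show "cmod (hankel_coeff lam f n * z ^ n) \<le> B * cmod z ^ n" for n
      using B by (simp add: norm_mult norm_power mult_right_mono)
  qed
  have "hankel lam f holomorphic_on unit_disk"
    by (rule power_series_holomorphic[where a = "hankel_coeff lam f"])
       (use s2 in \<open>auto simp: hankel_def intro!: summable_sums\<close>)
  with s1 s2 show ?thesis
    unfolding hankel_well_defined_def f_def by blast
qed

end

(*
  On Taylor coefficients the squared Dirichlet norm is sum_n max(1,n) |a_n|^2; this is Parseval on
  disks: monomials are orthogonal because Lebesgue measure is rotation invariant, and |z|^2 is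
  uniformly distributed.

  The rows n >= N of the Hankel matrix are bounded by splitting at k = n.  For k <= n one uses
  lam(n+k) <= lam(n) and a weighted discrete Hardy inequality, whose Muckenhoupt constant is
  sup_{m >= N} (sum_{n >= m} n lam(n)^2) (1 + H_m); for k > n one uses lam(n+k) <= lam(k) = o(1/k) and
  Cauchy-Schwarz.  So (iii) makes the row tails uniformly small, which gives compactness by a
  diagonal argument.  Under compactness the images of the kernels k_t converge to 0 because their
  coefficients do.  Conversely, testing on k_t with t = 1 - 1/(2m) recovers (iii), since the n-th
  coefficient of the image of K_t is at least of order lam(n+m) log m.
*)

theory Submission
  imports Defs "HOL-Real_Asymp.Real_Asymp"
begin

text \<open>The logarithm in (iii) has one source: at t = 1 - 1/(2m) both ||K_t||^2 and the sum of
  1/\<open>dirichlet_weight\<close> k over k <= m are of order log m. A coefficient of size lam(n+m)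
  log m, divided by ||K_t|| and squared, is therefore of order lam(n+m)^2 log m, so small images
  mean small products of log m with tails. In the sufficiency direction the same log m is the second
  factor of the Muckenhoupt constant. Since lam is nonnegative, rows can be estimated through |a_k|.
  The bound lam(k) = o(1/k) is hidden in (iii): by monotonicity the block from k/2 to k alone
  contributes at least (k lam(k))^2 / 4 to a tail. The coefficients of the images of k_t vanish in
  the limit because the row sums for K_t stay bounded while ||K_t|| tends to infinity; boundedness
  uses the convergence of sum n lam(n)^2, which compactness yields through the image of the constant
  1. The test at m sees lam(n+m) with n >= m, hence tails starting at 2m; since log(2m) and log m
  are comparable, this doubling does not affect the little-o.\<close>

section \<open>Rotation invariance and Parseval on disks\<close>

text \<open>Carries measure-theoretic facts about orthogonal maps of \<open>real^2\<close> over to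
  the complex plane; boxes correspond to boxes, and boxes determine the measure.\<close>

lemma distr_lborel_vec2_complex:
  "distr lborel borel (\<lambda>x::real^2. Complex (x$1) (x$2)) = (lborel :: complex measure)"
proof (rule lborel_eqI[symmetric])
  let ?U = "\<lambda>x::real^2. Complex (x$1) (x$2)"
  have U[measurable]: "?U \<in> borel_measurable borel"
    by (intro borel_measurable_continuous_onI) (auto simp: Complex_eq intro!: continuous_intros)
  fix l u :: complex assume lu: "\<And>b. b \<in> Basis \<Longrightarrow> l \<bullet> b \<le> u \<bullet> b"
  define l' where "l' = (vector [Re l, Im l] :: real^2)"
  define u' where "u' = (vector [Re u, Im u] :: real^2)"
  have le: "Re l \<le> Re u" "Im l \<le> Im u"
    using lu[of 1] lu[of \<i>] by (auto simp: Basis_complex_def)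
  have B: "(Basis :: (real^2) set) = {axis 1 1, axis 2 1}"
    by (auto simp: Basis_vec_def UNIV_2)
  have "?U -` box l u = box l' u'"
    by (auto simp: mem_box_cart in_box_complex_iff l'_def u'_def forall_2)
  then have "emeasure (distr lborel borel ?U) (box l u) = emeasure lborel (box l' u')"
    by (simp add: emeasure_distr)
  also have "\<dots> = (\<Prod>b\<in>Basis. (u' - l') \<bullet> b)"
    by (rule emeasure_lborel_box) (use le in \<open>auto simp: B inner_axis l'_def u'_def\<close>)
  also have "(\<Prod>b\<in>Basis. (u' - l') \<bullet> b) = (\<Prod>b\<in>Basis. (u - l) \<bullet> b)"
  proof -
    have "axis 1 1 \<noteq> (axis 2 1 :: real^2)" by (simp add: axis_eq_axis)
    then show ?thesis
      unfolding B by (auto simp: inner_axis l'_def u'_def Basis_complex_def)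
  qed
  finally show "emeasure (distr lborel borel ?U) (box l u) = (\<Prod>b\<in>Basis. (u - l) \<bullet> b)" .
qed simp

lemma distr_lborel_complex_rotation:
  assumes w: "cmod w = 1"
  shows "distr lborel borel ((*) w) = (lborel :: complex measure)"
proof (rule lborel_eqI[symmetric])
  let ?U = "\<lambda>x::real^2. Complex (x$1) (x$2)"
  let ?V = "\<lambda>z. (vector [Re z, Im z] :: real^2)"
  have U[measurable]: "?U \<in> borel_measurable borel"
    by (intro borel_measurable_continuous_onI) (auto simp: Complex_eq intro!: continuous_intros)
  have UV: "?U (?V z) = z" for z by (simp add: complex_eq_iff)
  have VU: "?V (?U x) = x" for x by (simp add: vec_eq_iff forall_2)
  \<comment> \<open>Multiplication by \<open>cnj w\<close>, the inverse rotation, seen on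
    \<open>real^2\<close>: the preimage of a box under multiplication by w thus becomes an image
    under the orthogonal map \<open>T\<close>.\<close>
  define T where "T = (\<lambda>x. ?V (cnj w * ?U x))"
  have ww: "w * cnj w = 1" using w complex_norm_square[of w] by simp
  have T: "orthogonal_transformation T"
    unfolding orthogonal_transformation
  proof
    show "linear T"
      by (rule linearI) (auto simp: T_def vec_eq_iff forall_2 algebra_simps)
    show "\<forall>v. norm (T v) = norm v"
    proof
      fix v :: "real^2"
      have n: "norm (?V z) = cmod z" for z
        by (simp add: norm_vec_def L2_set_def sum_2 cmod_def)
      have "norm (T v) = cmod (cnj w * ?U v)" unfolding T_def by (rule n)
      also have "\<dots> = cmod (?U v)" using w by (simp add: norm_mult)
      also have "\<dots> = norm (?V (?U v))" by (rule n[symmetric])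
      finally show "norm (T v) = norm v" by (simp only: VU)
    qed
  qed
  fix l u :: complex assume lu: "\<And>b. b \<in> Basis \<Longrightarrow> l \<bullet> b \<le> u \<bullet> b"
  define B where "B = ?U -` box l u"
  have Bs[measurable]: "B \<in> sets borel"
    unfolding B_def using measurable_sets_borel[OF U] by auto
  have eB: "emeasure lborel B = emeasure lborel (box l u)"
    unfolding B_def by (subst distr_lborel_vec2_complex[symmetric]) (simp add: emeasure_distr)
  have fin: "emeasure lborel B < \<infinity>" unfolding eB by (rule emeasure_lborel_box_finite)
  have img: "?U -` ((*) w -` box l u) = T ` B"
  proof (intro equalityI subsetI)
    fix x assume "x \<in> ?U -` ((*) w -` box l u)"
    then have "w * ?U x \<in> box l u" by simp
    then have "?V (w * ?U x) \<in> B" by (simp only: B_def vimage_eq UV)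
    moreover have "T (?V (w * ?U x)) = x"
      unfolding T_def UV using ww VU by (simp add: mult.assoc[symmetric] mult.commute[of "cnj w"])
    ultimately show "x \<in> T ` B" by (metis imageI)
  next
    fix x assume "x \<in> T ` B"
    then obtain y where y: "y \<in> B" "x = T y" by auto
    have "w * ?U x = ?U y"
      unfolding y T_def UV using ww by (simp add: mult.assoc[symmetric])
    then show "x \<in> ?U -` ((*) w -` box l u)" using y by (simp add: B_def)
  qed
  have wm: "(*) w \<in> borel_measurable borel" by simp
  have TB: "T ` B \<in> sets borel"
    unfolding img[symmetric] by (intro measurable_sets_borel[OF U] measurable_sets_borel[OF wm]) simp
  have lm: "B \<in> lmeasurable"
    using fin Bs by (auto simp: fmeasurable_def)
  have "emeasure (distr lborel borel ((*) w)) (box l u) = emeasure lborel ((*) w -` box l u)"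
    by (simp add: emeasure_distr)
  also have "\<dots> = emeasure lborel (T ` B)"
    unfolding img[symmetric] 
    by (subst distr_lborel_vec2_complex[symmetric])
       (use measurable_sets_borel[OF wm, of "box l u"] in \<open>simp add: emeasure_distr\<close>)
  also have "\<dots> = emeasure lebesgue (T ` B)"
    using TB by simp
  also have "\<dots> = measure lebesgue (T ` B)"
    by (rule emeasure_eq_measure2[OF measurable_orthogonal_image[OF T lm]])
  also have "\<dots> = measure lebesgue B" by (simp add: measure_orthogonal_image[OF T lm])
  also have "\<dots> = emeasure lebesgue B"
    by (rule emeasure_eq_measure2[OF lm, symmetric])
  also have "\<dots> = emeasure lborel B" using Bs by simp
  also have "\<dots> = (\<Prod>b\<in>Basis. (u - l) \<bullet> b)" unfolding eB using lu by (rule emeasure_lborel_box)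
  finally show "emeasure (distr lborel borel ((*) w)) (box l u) = (\<Prod>b\<in>Basis. (u - l) \<bullet> b)" .
qed simp

text \<open>Rotation by the angle \<open>\<pi> / (n - m)\<close> changes the sign of the integrand.\<close>

lemma integral_ball_monomials_orthogonal:
  fixes r :: real
  assumes "n \<noteq> m"
  shows "(LINT z|lborel. indicator (ball 0 r) z *\<^sub>R (z ^ n * cnj (z ^ m))) = 0"
proof -
  define a where "a = pi / (real n - real m)"
  define w where "w = cis a"
  define F where "F = (\<lambda>z. indicator (ball 0 r) z *\<^sub>R (z ^ n * cnj (z ^ m)) :: complex)"
  have Fm: "F \<in> borel_measurable borel"
    unfolding F_def
    by (intro borel_measurable_scaleR borel_measurable_indicator borel_measurable_continuous_onI)
       (auto intro!: continuous_intros)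
  have "w ^ n * cnj (w ^ m) = cis (real n * a - real m * a)"
    by (simp add: w_def Complex.DeMoivre cis_cnj cis_mult)
  also have "real n * a - real m * a = pi"
  proof -
    have "(real n - real m) * a = pi" using assms by (simp add: a_def)
    then show ?thesis by (simp only: left_diff_distrib)
  qed
  finally have w: "w ^ n * cnj (w ^ m) = -1" by simp
  have F: "F (w * z) = - F z" for z
  proof -
    have "F (w * z) = indicator (ball 0 r) z *\<^sub>R ((w ^ n * cnj (w ^ m)) * (z ^ n * cnj (z ^ m)))"
      by (simp add: F_def w_def norm_mult power_mult_distrib indicator_def mult_ac)
    also have "\<dots> = - F z" unfolding w F_def by simp
    finally show ?thesis .
  qed
  have "integral\<^sup>L lborel F = integral\<^sup>L (distr lborel borel ((*) w)) F"
    by (subst distr_lborel_complex_rotation) (simp_all add: w_def)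
  also have "\<dots> = integral\<^sup>L lborel (\<lambda>z. F (w * z))"
    by (rule integral_distr) (use Fm in auto)
  also have "\<dots> = - integral\<^sup>L lborel F" unfolding F by simp
  finally show ?thesis unfolding F_def by (simp add: equation_minus_iff)
qed

text \<open>Plays the role of polar coordinates. Finite values on the half-lines
  \<open>{x<..}\<close> determine both measures, and the part of the disk with |z|^2 > x is an
  annulus of area pi (r^2 - max 0 x).\<close>

lemma distr_ball_norm_sq:
  assumes r: "r > 0"
  shows "distr (restrict_space lborel (ball (0::complex) r)) borel (\<lambda>z. (cmod z)\<^sup>2)
         = density lborel (\<lambda>s. ennreal pi * indicator {0..r\<^sup>2} s)" (is "?M = ?N")
proof -
  let ?R = "restrict_space lborel (ball (0::complex) r)"
  have fm[measurable]: "(\<lambda>z. (cmod z)\<^sup>2) \<in> borel_measurable ?R"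
    by (intro measurable_restrict_space1) measurable
  have area: "emeasure lborel (cball (0::complex) x) = ennreal (pi * x\<^sup>2)" 
             "emeasure lborel (ball (0::complex) x) = ennreal (pi * x\<^sup>2)" if "x \<ge> 0" for x
    using that by (auto simp: emeasure_cball emeasure_ball unit_ball_vol_2)
  have M: "emeasure ?M {x<..} = ennreal (pi * (r\<^sup>2 - max 0 x))" if x: "x \<le> r\<^sup>2" for x
  proof -
    define q where "q = sqrt (max 0 x)"
    have q: "0 \<le> q" "q \<le> r"  using x r by (auto simp: q_def intro: real_le_lsqrt)
    have "emeasure ?M {x<..} = emeasure ?R ((\<lambda>z. (cmod z)\<^sup>2) -` {x<..} \<inter> ball 0 r)"
      by (simp add: emeasure_distr space_restrict_space)
    also have "\<dots> = emeasure lborel ((\<lambda>z. (cmod z)\<^sup>2) -` {x<..} \<inter> ball 0 r)"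
      by (rule emeasure_restrict_space) auto
    also have "\<dots> = ennreal (pi * (r\<^sup>2 - max 0 x))"
    proof (cases "x < 0")
      case True
      then have "(\<lambda>z. (cmod z)\<^sup>2) -` {x<..} \<inter> ball 0 r = ball 0 r"
        by (auto intro: less_le_trans[OF _ zero_le_power2])
      then show ?thesis using area(2)[of r] r True by simp
    next
      case False
      \<comment> \<open>At q = r the intersection is the open disk and not the closed one; both have
        area pi q^2.\<close>
      have int: "emeasure lborel (ball (0::complex) r \<inter> cball 0 q) = ennreal (pi * q\<^sup>2)"
      proof (cases "q < r")
        case True
        then have "ball (0::complex) r \<inter> cball 0 q = cball 0 q" by auto
        then show ?thesis using area(1) q by simp
      next
        case False
        then have "ball (0::complex) r \<inter> cball 0 q = ball 0 r" "q = r" using q by auto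
        then show ?thesis using area(2) r by simp
      qed
      from False have "(\<lambda>z. (cmod z)\<^sup>2) -` {x<..} \<inter> ball 0 r = ball 0 r - (ball 0 r \<inter> cball 0 q)"
        by (auto simp: q_def not_le dest: real_less_lsqrt real_less_rsqrt) 
           (smt (verit) real_sqrt_less_iff real_sqrt_abs norm_ge_zero)+
      also have "emeasure lborel \<dots> = emeasure lborel (ball (0::complex) r) - emeasure lborel (ball (0::complex) r \<inter> cball 0 q)"
        by (rule emeasure_Diff) (auto simp: int)
      also note int
      also have "emeasure lborel (ball (0::complex) r) = ennreal (pi * r\<^sup>2)" using area r by simp
      finally show ?thesis using False q by (simp add: q_def ennreal_minus right_diff_distrib)
    qed
    finally show ?thesis .
  qed
  have M0: "emeasure ?M {x<..} = 0" if "\<not> x \<le> r\<^sup>2" for x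
  proof -
    have e: "(\<lambda>z. (cmod z)\<^sup>2) -` {x<..} \<inter> ball (0::complex) r = {}"
      using that by (auto dest: power_strict_mono[of _ _ 2])
         (smt (verit) norm_ge_zero power_mono)
    then show ?thesis using r by (simp add: emeasure_distr space_restrict_space)
  qed
  have N: "emeasure ?N {x<..} = ennreal (pi * (r\<^sup>2 - max 0 x))" if x: "x \<le> r\<^sup>2" for x
  proof -
    have "emeasure ?N {x<..} = (\<integral>\<^sup>+s. ennreal pi * indicator ({0..r\<^sup>2} \<inter> {x<..}) s \<partial>lborel)"
      by (subst emeasure_density) (auto simp: indicator_inter_arith mult.assoc)
    also have "\<dots> = ennreal pi * emeasure lborel ({0..r\<^sup>2} \<inter> {x<..})"
      by (subst nn_integral_cmult_indicator) auto
    also have "{0..r\<^sup>2} \<inter> {x<..} = (if x < 0 then {0..r\<^sup>2} else {x<..r\<^sup>2})" by auto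
    also have "emeasure lborel \<dots> = ennreal (r\<^sup>2 - max 0 x)"
      using x by auto
    finally show ?thesis by (simp add: ennreal_mult')
  qed
  have N0: "emeasure ?N {x<..} = 0" if "\<not> x \<le> r\<^sup>2" for x
  proof -
    have "emeasure ?N {x<..} = (\<integral>\<^sup>+s. ennreal pi * indicator ({0..r\<^sup>2} \<inter> {x<..}) s \<partial>lborel)"
      by (subst emeasure_density) (auto simp: indicator_inter_arith mult.assoc)
    also have "{0..r\<^sup>2} \<inter> {x<..} = {}" using that by auto
    finally show ?thesis by simp
  qed
  show ?thesis
  proof (rule measure_eqI_lessThan)
    fix x show "emeasure ?M {x<..} < \<infinity>" using M[of x] M0[of x] by (cases "x \<le> r\<^sup>2") auto
    show "emeasure ?M {x<..} = emeasure ?N {x<..}"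
      using M[of x] M0[of x] N[of x] N0[of x] by (cases "x \<le> r\<^sup>2") auto
  qed auto
qed

text \<open>The substitution s = |z|^2 leaves s^n against the constant density pi on
  [0, r^2].\<close>

lemma nn_integral_ball_norm_power:
  assumes r: "r > 0"
  shows "(\<integral>\<^sup>+z. ennreal ((cmod z) ^ (2 * n)) * indicator (ball 0 r) z \<partial>lborel) = ennreal (pi * r ^ (2 * n + 2) / real (n + 1))"
proof -
  let ?R = "restrict_space lborel (ball (0::complex) r)"
  have fm[measurable]: "(\<lambda>z. (cmod z)\<^sup>2) \<in> borel_measurable ?R"
    by (intro measurable_restrict_space1) measurable
  have "(\<integral>\<^sup>+z. ennreal ((cmod z) ^ (2 * n)) * indicator (ball 0 r) z \<partial>lborel)
      = (\<integral>\<^sup>+z. ennreal (((cmod z)\<^sup>2) ^ n) \<partial>?R)"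
    by (subst nn_integral_restrict_space) (auto simp: power_mult)
  also have "\<dots> = (\<integral>\<^sup>+s. ennreal (s ^ n) \<partial>distr ?R borel (\<lambda>z. (cmod z)\<^sup>2))"
    by (subst nn_integral_distr) auto
  also have "\<dots> = (\<integral>\<^sup>+s. ennreal pi * (ennreal (s ^ n) * indicator {0..r\<^sup>2} s) \<partial>lborel)"
    unfolding distr_ball_norm_sq[OF r]
    by (subst nn_integral_density) (auto simp: mult_ac)
  also have "\<dots> = ennreal pi * (\<integral>\<^sup>+s. ennreal (s ^ n) * indicator {0..r\<^sup>2} s \<partial>lborel)"
    by (rule nn_integral_cmult) auto
  also have "(\<integral>\<^sup>+s. ennreal (s ^ n) * indicator {0..r\<^sup>2} s \<partial>lborel)
     = ennreal ((r\<^sup>2) ^ (n + 1) / real (n + 1) - 0 ^ (n + 1) / real (n + 1))"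
    by (rule nn_integral_FTC_Icc[where F = "\<lambda>s. s ^ (n + 1) / real (n + 1)"])
       (use DERIV_cdivide[OF DERIV_pow[of "n + 1"], of "real (n + 1)"] in auto)
  also have "(r\<^sup>2) ^ (n + 1) = r ^ (2 * n + 2)" by (simp add: power2_eq_square power_mult)
  finally show ?thesis by (simp add: ennreal_mult'[symmetric])
qed

section \<open>Parseval for power series on disks\<close>

lemma integrable_ball_continuous:
  fixes F :: "complex \<Rightarrow> complex"
  assumes "continuous_on UNIV F"
  shows "integrable lborel (\<lambda>z. indicator (ball 0 r) z *\<^sub>R F z)"
proof -
  have "set_integrable lborel (cball 0 r) F"
    unfolding set_integrable_def
    by (rule borel_integrable_compact) (use assms continuous_on_subset in auto)
  then have "set_integrable lborel (ball 0 r) F"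
    by (rule set_integrable_subset) auto
  then show ?thesis by (simp add: set_integrable_def)
qed

lemma nn_integral_ball_polynomial:
  fixes c :: "nat \<Rightarrow> complex"
  assumes r: "r > 0"
  shows "(\<integral>\<^sup>+z. ennreal ((cmod (\<Sum>n<N. c n * z ^ n))\<^sup>2) * indicator (ball 0 r) z \<partial>lborel)
         = (\<Sum>n<N. ennreal (pi * (cmod (c n))\<^sup>2 * r ^ (2 * n + 2) / real (n + 1)))"
proof -
  define I where "I = (\<lambda>z::complex. indicator (ball 0 r) z :: real)"
  define S where "S = (\<lambda>z. \<Sum>n<N. c n * z ^ n)"
  define E where "E = (\<lambda>n m z. I z *\<^sub>R (z ^ n * cnj (z ^ m)))"
  have E: "integrable lborel (E n m)" for n m
    unfolding E_def I_def by (rule integrable_ball_continuous) (intro continuous_intros)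
  have diag: "integral\<^sup>L lborel (E n n) = of_real (pi * r ^ (2 * n + 2) / real (n + 1))" for n
  proof -
    have e: "E n n = (\<lambda>z. complex_of_real (cmod z ^ (2 * n) * I z))"
    proof
      fix z
      have "z ^ n * cnj (z ^ n) = complex_of_real ((cmod (z ^ n))\<^sup>2)"
        by (rule complex_norm_square[symmetric])
      also have "(cmod (z ^ n))\<^sup>2 = cmod z ^ (2 * n)"
        by (simp add: norm_power power_even_eq)
      finally have "z ^ n * cnj (z ^ n) = complex_of_real (cmod z ^ (2 * n))" .
      then show "E n n z = complex_of_real (cmod z ^ (2 * n) * I z)"
        by (simp add: E_def scaleR_conv_of_real mult.commute)
    qed
    have "integral\<^sup>L lborel (\<lambda>z. cmod z ^ (2 * n) * I z) = enn2real (\<integral>\<^sup>+z. ennreal (cmod z ^ (2 * n) * I z) \<partial>lborel)"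
      unfolding I_def
      by (rule integral_eq_nn_integral) (auto intro!: borel_measurable_times borel_measurable_indicator simp: I_def)
    also have "(\<integral>\<^sup>+z. ennreal (cmod z ^ (2 * n) * I z) \<partial>lborel)
        = (\<integral>\<^sup>+z. ennreal (cmod z ^ (2 * n)) * indicator (ball 0 r) z \<partial>lborel)"
      by (intro nn_integral_cong) (auto simp: I_def indicator_def)
    also have "\<dots> = ennreal (pi * r ^ (2 * n + 2) / real (n + 1))"
      by (rule nn_integral_ball_norm_power[OF r])
    also have "enn2real \<dots> = pi * r ^ (2 * n + 2) / real (n + 1)"
      using r by (intro enn2real_ennreal) auto
    finally show ?thesis unfolding e by (simp only: integral_complex_of_real)
  qed
  have sq: "complex_of_real (I z * (cmod (S z))\<^sup>2) = (\<Sum>n<N. \<Sum>m<N. c n * cnj (c m) * E n m z)" for z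
  proof -
    have "complex_of_real (I z * (cmod (S z))\<^sup>2) = complex_of_real (I z) * (S z * cnj (S z))"
      by (simp add: complex_norm_square[symmetric])
    also have "S z * cnj (S z) = (\<Sum>n<N. \<Sum>m<N. (c n * z ^ n) * cnj (c m * z ^ m))"
      unfolding S_def cnj_sum by (rule sum_product)
    finally show ?thesis
      by (simp add: sum_distrib_left E_def scaleR_conv_of_real mult_ac)
  qed
  have int: "integrable lborel (\<lambda>z. complex_of_real (I z * (cmod (S z))\<^sup>2))"
    unfolding sq by (intro Bochner_Integration.integrable_sum integrable_mult_right E)
  then have int': "integrable lborel (\<lambda>z. I z * (cmod (S z))\<^sup>2)"
    by (simp only: complex_of_real_integrable_eq)
  have "complex_of_real (integral\<^sup>L lborel (\<lambda>z. I z * (cmod (S z))\<^sup>2)) 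
     = integral\<^sup>L lborel (\<lambda>z. \<Sum>n<N. \<Sum>m<N. c n * cnj (c m) * E n m z)"
    unfolding sq[symmetric] by (rule integral_complex_of_real[symmetric])
  also have "\<dots> = (\<Sum>n<N. \<Sum>m<N. c n * cnj (c m) * integral\<^sup>L lborel (E n m))"
    by (subst Bochner_Integration.integral_sum; (intro Bochner_Integration.integrable_sum integrable_mult_right E)?)+ 
       (simp add: E)
  also have "\<dots> = (\<Sum>n<N. \<Sum>m<N. if m = n then c n * cnj (c n) * of_real (pi * r ^ (2 * n + 2) / real (n + 1)) else 0)"
  proof (intro sum.cong refl)
    fix n m
    show "c n * cnj (c m) * integral\<^sup>L lborel (E n m) = (if m = n then c n * cnj (c n) * of_real (pi * r ^ (2 * n + 2) / real (n + 1)) else 0)"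
      using integral_ball_monomials_orthogonal[of n m r] diag[of n]
      by (cases "m = n") (simp_all add: E_def I_def)
  qed
  also have "\<dots> = (\<Sum>n<N. of_real (pi * (cmod (c n))\<^sup>2 * r ^ (2 * n + 2) / real (n + 1)))"
    by (simp add: sum.delta complex_norm_square[symmetric] mult_ac)
  finally have val: "integral\<^sup>L lborel (\<lambda>z. I z * (cmod (S z))\<^sup>2) = (\<Sum>n<N. pi * (cmod (c n))\<^sup>2 * r ^ (2 * n + 2) / real (n + 1))"
    by (simp only: of_real_sum[symmetric] of_real_eq_iff)
  have "(\<integral>\<^sup>+z. ennreal ((cmod (S z))\<^sup>2) * indicator (ball 0 r) z \<partial>lborel) = (\<integral>\<^sup>+z. ennreal (I z * (cmod (S z))\<^sup>2) \<partial>lborel)"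
    by (intro nn_integral_cong) (auto simp: I_def indicator_def)
  also have "\<dots> = ennreal (integral\<^sup>L lborel (\<lambda>z. I z * (cmod (S z))\<^sup>2))"
    by (rule nn_integral_eq_integral[OF int']) (auto simp: I_def)
  also have "\<dots> = (\<Sum>n<N. ennreal (pi * (cmod (c n))\<^sup>2 * r ^ (2 * n + 2) / real (n + 1)))"
    unfolding val using r by (subst sum_ennreal) auto
  finally show ?thesis by (simp add: S_def)
qed

text \<open>Below radius 1 the partial sums are bounded uniformly, so dominated convergence passes
  from polynomials to the series.\<close>

lemma nn_integral_ball_power_series_less:
  fixes c :: "nat \<Rightarrow> complex"
  assumes g: "\<And>z. cmod z < 1 \<Longrightarrow> (\<lambda>n. c n * z ^ n) sums g z" and r: "0 < r" "r < 1"
  shows "(\<integral>\<^sup>+z. ennreal ((cmod (g z))\<^sup>2) * indicator (ball 0 r) z \<partial>lborel)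
         = (\<Sum>n. ennreal (pi * (cmod (c n))\<^sup>2 * r ^ (2 * n + 2) / real (n + 1)))"
proof -
  define u where "u = (\<lambda>N z. ennreal ((cmod (\<Sum>n<N. c n * z ^ n))\<^sup>2) * indicator (ball 0 r) z)"
  define v where "v = (\<lambda>z. ennreal ((cmod (g z))\<^sup>2) * indicator (ball 0 r) z)"
  define B where "B = (\<Sum>n. cmod (c n) * r ^ n)"
  \<comment> \<open>Convergence at the larger radius (1 + r) / 2 < 1 gives absolute convergence at
    r.\<close>
  have "summable (\<lambda>n. c n * (complex_of_real ((1 + r) / 2)) ^ n)"
    by (rule sums_summable[OF g]) (use r in \<open>simp del: of_real_add of_real_divide\<close>)
  then have "summable (\<lambda>n. cmod (c n * complex_of_real r ^ n))"
    by (rule powser_insidea) (use r in \<open>simp del: of_real_add of_real_divide\<close>)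
  then have sB: "summable (\<lambda>n. cmod (c n) * r ^ n)"
    using r by (simp add: norm_mult norm_power)
  have B: "cmod (\<Sum>n<N. c n * z ^ n) \<le> B" if "cmod z < r" for N z
  proof -
    have "cmod (\<Sum>n<N. c n * z ^ n) \<le> (\<Sum>n<N. cmod (c n) * r ^ n)"
      by (rule sum_norm_le)
         (use that in \<open>auto simp: norm_mult norm_power intro!: mult_left_mono power_mono\<close>)
    also have "\<dots> \<le> B" unfolding B_def
      by (rule sum_le_suminf[OF sB]) (use r in auto)
    finally show ?thesis .
  qed
  have um: "u N \<in> borel_measurable lborel" for N
    unfolding u_def by (intro borel_measurable_times_ennreal measurable_compose[OF _ measurable_ennreal]
         borel_measurable_indicator) (auto intro!: borel_measurable_continuous_onI continuous_intros)
  have lim: "(\<lambda>N. u N z) \<longlonglongrightarrow> v z" for z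
  proof (cases "cmod z < r")
    case True
    then have "(\<lambda>N. ennreal ((cmod (\<Sum>n<N. c n * z ^ n))\<^sup>2)) \<longlonglongrightarrow> ennreal ((cmod (g z))\<^sup>2)"
      using g[of z] r unfolding sums_def by (intro tendsto_intros tendsto_ennrealI) auto
    then show ?thesis using True by (simp add: u_def v_def)
  qed (simp add: u_def v_def)
  have vm: "v \<in> borel_measurable lborel"
    by (rule borel_measurable_LIMSEQ_order[OF lim um])
  have "(\<lambda>N. integral\<^sup>N lborel (u N)) \<longlonglongrightarrow> integral\<^sup>N lborel v"
  proof (rule nn_integral_dominated_convergence[where w = "\<lambda>z. ennreal (B\<^sup>2) * indicator (ball 0 r) z"])
    show "(\<integral>\<^sup>+z. ennreal (B\<^sup>2) * indicator (ball (0::complex) r) z \<partial>lborel) < \<infinity>"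
      using r by (subst nn_integral_cmult_indicator) (auto simp: emeasure_ball ennreal_mult_less_top)
    show "AE z in lborel. u N z \<le> ennreal (B\<^sup>2) * indicator (ball 0 r) z" for N
      using B by (auto simp: u_def indicator_def intro!: AE_I2 ennreal_leI power_mono)
    show "(\<lambda>z. ennreal (B\<^sup>2) * indicator (ball (0::complex) r) z) \<in> borel_measurable lborel"
      by (intro borel_measurable_times_ennreal borel_measurable_indicator) auto
  qed (use um vm lim in auto)
  moreover have "(\<lambda>N. integral\<^sup>N lborel (u N)) \<longlonglongrightarrow> (\<Sum>n. ennreal (pi * (cmod (c n))\<^sup>2 * r ^ (2 * n + 2) / real (n + 1)))"
    unfolding u_def nn_integral_ball_polynomial[OF r(1)] by (intro summable_LIMSEQ) auto
  ultimately show ?thesis unfolding v_def by (rule LIMSEQ_unique)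
qed

text \<open>Monotone convergence on both sides as the radius increases to 1; the common value may be
  infinite.\<close>

lemma nn_integral_disk_power_series:
  fixes c :: "nat \<Rightarrow> complex"
  assumes g: "\<And>z. cmod z < 1 \<Longrightarrow> (\<lambda>n. c n * z ^ n) sums g z"
  shows "(\<integral>\<^sup>+z. ennreal ((cmod (g z))\<^sup>2) * indicator (ball 0 1) z \<partial>lborel)
         = (\<Sum>n. ennreal (pi * (cmod (c n))\<^sup>2 / real (n + 1)))"
proof -
  define r where "r = (\<lambda>j. 1 - 1 / real (j + 2))"
  have r: "0 < r j" "r j < 1" for j by (auto simp: r_def field_simps)
  have r_mono: "r i \<le> r j" if "i \<le> j" for i j
    using that by (auto simp: r_def frac_le)
  have r_lim: "r \<longlonglongrightarrow> 1"
  proof -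
    have "(\<lambda>j. 1 - 1 / real (j + 2)) \<longlonglongrightarrow> 1 - 0"
      by (intro tendsto_intros LIMSEQ_ignore_initial_segment lim_1_over_n)
    then show ?thesis by (simp add: r_def)
  qed
  have "g holomorphic_on ball 0 1"
    by (rule power_series_holomorphic[where a = c]) (use g in auto)
  then have cont: "continuous_on (ball 0 1) g" by (rule holomorphic_on_imp_continuous_on)
  have gm: "(\<lambda>z. ennreal ((cmod (g z))\<^sup>2) * indicator (ball 0 s) z) \<in> borel_measurable lborel" if "s \<le> 1" for s
  proof -
    have "(\<lambda>z. indicator (ball 0 s) z *\<^sub>R g z) \<in> borel_measurable borel"
      by (rule borel_measurable_continuous_on_indicator)
         (use that in \<open>auto intro: continuous_on_subset[OF cont]\<close>)
    then have "(\<lambda>z. ennreal ((cmod (indicator (ball 0 s) z *\<^sub>R g z))\<^sup>2)) \<in> borel_measurable lborel"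
      by measurable
    also have "(\<lambda>z. ennreal ((cmod (indicator (ball 0 s) z *\<^sub>R g z))\<^sup>2)) = (\<lambda>z. ennreal ((cmod (g z))\<^sup>2) * indicator (ball 0 s) z)"
      by (auto simp: indicator_def)
    finally show ?thesis .
  qed
  have "(\<lambda>j. \<integral>\<^sup>+z. ennreal ((cmod (g z))\<^sup>2) * indicator (ball 0 (r j)) z \<partial>lborel)
     \<longlonglongrightarrow> (\<integral>\<^sup>+z. ennreal ((cmod (g z))\<^sup>2) * indicator (ball 0 1) z \<partial>lborel)"
  proof (rule nn_integral_LIMSEQ)
    show "mono (\<lambda>j z. ennreal ((cmod (g z))\<^sup>2) * indicator (ball 0 (r j)) z)"
      using r_mono by (fastforce simp: mono_def le_fun_def indicator_def)
    fix z :: complex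
    have "\<forall>\<^sub>F j in sequentially. ennreal ((cmod (g z))\<^sup>2) * indicator (ball 0 (r j)) z = ennreal ((cmod (g z))\<^sup>2) * indicator (ball 0 1) z"
    proof (cases "cmod z < 1")
      case True
      then show ?thesis using order_tendstoD(1)[OF r_lim, of "cmod z"]
        by (auto elim!: eventually_mono)
    next
      case False
      then have "\<not> cmod z < r j" for j using r(2)[of j] by linarith
      then show ?thesis using False by simp
    qed
    then show "(\<lambda>j. ennreal ((cmod (g z))\<^sup>2) * indicator (ball 0 (r j)) z) \<longlonglongrightarrow> ennreal ((cmod (g z))\<^sup>2) * indicator (ball 0 1) z"
      by (rule tendsto_eventually)
  qed (use gm less_imp_le[OF r(2)] in simp_all)
  moreover have eq: "(\<integral>\<^sup>+z. ennreal ((cmod (g z))\<^sup>2) * indicator (ball 0 (r j)) z \<partial>lborel)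
      = (\<Sum>n. ennreal (pi * (cmod (c n))\<^sup>2 * r j ^ (2 * n + 2) / real (n + 1)))" for j
    by (rule nn_integral_ball_power_series_less) (use g r in auto)
  have "(\<lambda>j. \<integral>\<^sup>+z. ennreal ((cmod (g z))\<^sup>2) * indicator (ball 0 (r j)) z \<partial>lborel)
     \<longlonglongrightarrow> (\<Sum>n. ennreal (pi * (cmod (c n))\<^sup>2 / real (n + 1)))"
    \<comment> \<open>The series is read as an integral over counting measure, so that monotone
      convergence applies to it as well.\<close>
    unfolding eq nn_integral_count_space_nat[symmetric]
  proof (rule nn_integral_LIMSEQ)
    show "mono (\<lambda>j n. ennreal (pi * (cmod (c n))\<^sup>2 * r j ^ (2 * n + 2) / real (n + 1)))"
        unfolding mono_def le_fun_def
      by (intro allI impI ennreal_leI divide_right_mono mult_left_mono power_mono r_mono less_imp_le[OF r(1)]) auto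
    fix n
    have "(\<lambda>j. ennreal (pi * (cmod (c n))\<^sup>2 * r j ^ (2 * n + 2) / real (n + 1))) \<longlonglongrightarrow> ennreal (pi * (cmod (c n))\<^sup>2 * 1 ^ (2 * n + 2) / real (n + 1))"
      by (intro tendsto_ennrealI tendsto_intros r_lim) auto
    then show "(\<lambda>j. ennreal (pi * (cmod (c n))\<^sup>2 * r j ^ (2 * n + 2) / real (n + 1))) \<longlonglongrightarrow> ennreal (pi * (cmod (c n))\<^sup>2 / real (n + 1))"
      by simp
  qed auto
  ultimately show ?thesis by (blast intro: LIMSEQ_unique)
qed

text \<open>The value 1 at 0 carries the term |f(0)|^2. The reciprocals of the weights are the
  coefficients of K_t(z) as a power series in tz, and their partial sums are 1 + H_m.\<close>

definition dirichlet_weight :: "nat \<Rightarrow> real" where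
  "dirichlet_weight n = (if n = 0 then 1 else real n)"

lemma taylor_coeff_deriv: "taylor_coeff (deriv f) n = of_nat (n + 1) * taylor_coeff f (n + 1)"
  unfolding taylor_coeff_def by (simp add: funpow_Suc_right del: funpow.simps of_nat_Suc)

text \<open>Differentiation contributes (n+1)^2 and the area integral of |z^n|^2 contributes
  pi/(n+1), which leaves the weight n + 1 on the coefficient of index n + 1. Both sides may be
  infinite, so membership in \<open>dirichlet_space\<close> can be decided on coefficients.\<close>

lemma dirichlet_sqnorm_eq_suminf:
  assumes f: "f holomorphic_on unit_disk"
  shows "dirichlet_sqnorm f = (\<Sum>n. ennreal (dirichlet_weight n * (cmod (taylor_coeff f n))\<^sup>2))"
proof -
  have df: "deriv f holomorphic_on ball 0 1"
    by (rule holomorphic_deriv[OF f]) auto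
  have ser: "(\<lambda>n. taylor_coeff (deriv f) n * z ^ n) sums deriv f z" if "cmod z < 1" for z
    using holomorphic_power_series[OF df, of z] that by (simp add: taylor_coeff_def)
  have "(\<integral>\<^sup>+ z. ennreal ((cmod (deriv f z))\<^sup>2) \<partial>disk_area)
      = ennreal (1 / pi) * (\<integral>\<^sup>+ z. ennreal ((cmod (deriv f z))\<^sup>2) \<partial>restrict_space lborel unit_disk)"
    unfolding disk_area_def
  proof (rule nn_integral_scale_measure)
    have "deriv f \<in> borel_measurable (restrict_space borel unit_disk)"
      by (intro borel_measurable_continuous_on_restrict holomorphic_on_imp_continuous_on df)
    then have "deriv f \<in> borel_measurable (restrict_space lborel unit_disk)"
      by (simp add: measurable_def space_restrict_space sets_restrict_space)
    then show "(\<lambda>z. ennreal ((cmod (deriv f z))\<^sup>2)) \<in> borel_measurable (restrict_space lborel unit_disk)"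
      by measurable
  qed
  also have "\<dots> = ennreal (1 / pi) * (\<Sum>n. ennreal (pi * (cmod (taylor_coeff (deriv f) n))\<^sup>2 / real (n + 1)))"
    by (subst nn_integral_restrict_space) (auto simp: nn_integral_disk_power_series[OF ser])
  also have "\<dots> = (\<Sum>n. ennreal (1 / pi) * ennreal (pi * (cmod (taylor_coeff (deriv f) n))\<^sup>2 / real (n + 1)))"
    by simp
  also have "\<dots> = (\<Sum>n. ennreal (dirichlet_weight (Suc n) * (cmod (taylor_coeff f (Suc n)))\<^sup>2))"
  proof (intro suminf_cong)
    fix n
    have "1 / pi * (pi * (cmod (taylor_coeff (deriv f) n))\<^sup>2 / real (n + 1)) = real (n + 1) * (cmod (taylor_coeff f (n + 1)))\<^sup>2"
      unfolding taylor_coeff_deriv by (simp add: norm_mult power_mult_distrib power2_eq_square del: of_nat_Suc of_nat_add)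
    then show "ennreal (1 / pi) * ennreal (pi * (cmod (taylor_coeff (deriv f) n))\<^sup>2 / real (n + 1)) = ennreal (dirichlet_weight (Suc n) * (cmod (taylor_coeff f (Suc n)))\<^sup>2)"
      by (subst ennreal_mult'[symmetric]) (auto simp: dirichlet_weight_def)
  qed
  finally have "dirichlet_sqnorm f = (\<Sum>n. ennreal (dirichlet_weight (n + 1) * (cmod (taylor_coeff f (n + 1)))\<^sup>2))
      + (\<Sum>n<1. ennreal (dirichlet_weight n * (cmod (taylor_coeff f n))\<^sup>2))"
    by (simp add: dirichlet_sqnorm_def dirichlet_weight_def taylor_coeff_def add.commute)
  also have "\<dots> = (\<Sum>n. ennreal (dirichlet_weight n * (cmod (taylor_coeff f n))\<^sup>2))"
    by (rule suminf_offset[symmetric]) auto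
  finally show ?thesis .
qed

section \<open>Discrete Hardy-type inequalities\<close>

text \<open>Discrete form of dx / sqrt x = d(2 sqrt x): factor x - y as a difference of squares and
  use sqrt y <= sqrt x.\<close>

lemma diff_div_sqrt_le:
  assumes "0 \<le> y" "y \<le> (x::real)"
  shows "(x - y) / sqrt x \<le> 2 * (sqrt x - sqrt y)"
proof (cases "x = 0")
  case False
  then have x: "sqrt x > 0" using assms by simp
  have "x - y = (sqrt x - sqrt y) * (sqrt x + sqrt y)"
    using assms by (simp add: algebra_simps)
  also have "\<dots> \<le> (sqrt x - sqrt y) * (2 * sqrt x)"
    by (intro mult_left_mono) (use assms in auto)
  finally show ?thesis using x by (simp add: field_simps)
qed (use assms in auto)

text \<open>Cauchy--Schwarz with the weights \<open>w k * sqrt (L k)\<close>, \<open>L\<close> being the partial sums of \<open>1 / w\<close>;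
  both \<open>\<Sum> 1 / (w k * sqrt (L k))\<close> and \<open>\<Sum> u n / sqrt (U n)\<close> then telescope up to a factor 2.\<close>

lemma discrete_hardy_inequality:
  fixes u a w :: "nat \<Rightarrow> real"
  assumes u: "\<And>n. u n \<ge> 0" and w: "\<And>n. w n > 0" and A: "A \<ge> 0"
    and UL: "\<And>m. m \<le> M \<Longrightarrow> (\<Sum>n=m..M. u n) * (\<Sum>k\<le>m. 1 / w k) \<le> A"
  shows "(\<Sum>n\<le>M. u n * (\<Sum>k\<le>n. a k)\<^sup>2) \<le> 4 * A * (\<Sum>k\<le>M. w k * (a k)\<^sup>2)"
proof -
  define L where "L = (\<lambda>m. \<Sum>k\<le>m. 1 / w k)"
  define U where "U = (\<lambda>m. \<Sum>n=m..M. u n)"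
  define h where "h = (\<lambda>k. w k * sqrt (L k))"
  have L: "L m > 0" for m
    unfolding L_def by (rule sum_pos) (use w in auto)
  have U: "U m \<ge> 0" for m unfolding U_def by (rule sum_nonneg) (use u in auto)
  have h: "h k > 0" for k unfolding h_def using w L by simp
  have Lsum: "(\<Sum>k\<le>n. 1 / h k) \<le> 2 * sqrt (L n)" for n
  proof (induction n)
    case 0
    have "1 / h 0 = sqrt (L 0)" using w[of 0] L[of 0]
      by (simp add: h_def L_def real_sqrt_divide field_simps)
    then show ?case using L[of 0] by simp
  next
    case (Suc n)
    have "1 / h (Suc n) = (L (Suc n) - L n) / sqrt (L (Suc n))"
      by (simp add: h_def L_def)
    also have "\<dots> \<le> 2 * (sqrt (L (Suc n)) - sqrt (L n))"
      by (rule diff_div_sqrt_le) (use L[of n] w[of "Suc n"] in \<open>auto simp: L_def\<close>)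
    finally show ?case using Suc by simp
  qed
  \<comment> \<open>Downward induction from \<open>Suc M\<close>, where the sum is empty.\<close>
  have Usum: "(\<Sum>n=k..M. u n / sqrt (U n)) \<le> 2 * sqrt (U k)" if "k \<le> Suc M" for k
    using that
  proof (induction k rule: inc_induct)
    case base
    then show ?case by (simp add: U_def)
  next
    case (step k)
    have Uk: "U k = u k + U (Suc k)"
      unfolding U_def using step by (simp add: sum.atLeast_Suc_atMost)
    have "(\<Sum>n=k..M. u n / sqrt (U n)) = (U k - U (Suc k)) / sqrt (U k) + (\<Sum>n=Suc k..M. u n / sqrt (U n))"
      using step Uk by (simp add: sum.atLeast_Suc_atMost)
    also have "(U k - U (Suc k)) / sqrt (U k) \<le> 2 * (sqrt (U k) - sqrt (U (Suc k)))"
      by (rule diff_div_sqrt_le) (use U Uk u in auto)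
    finally show ?case using step by simp
  qed
  have ULs: "sqrt (U m) * sqrt (L m) \<le> sqrt A" if "m \<le> M" for m
    using UL[OF that] by (simp add: U_def L_def real_sqrt_mult[symmetric])
  \<comment> \<open>For n <= M, \<open>U n\<close> can vanish only if \<open>u n\<close> does, hence
    the case distinction before dividing by \<open>sqrt (U n)\<close>.\<close>
  have uL: "u n * sqrt (L n) \<le> sqrt A * (u n / sqrt (U n))" if "n \<le> M" for n
  proof (cases "u n = 0")
    case False
    have "u n \<le> U n" unfolding U_def
      by (rule member_le_sum) (use u that in auto)
    then have "U n > 0" using u[of n] False by linarith
    then show ?thesis using mult_left_mono[OF ULs[OF that] u[of n]] by (simp add: field_simps)
  qed simp
  have CS: "(\<Sum>k\<le>n. a k)\<^sup>2 \<le> 2 * sqrt (L n) * (\<Sum>k\<le>n. h k * (a k)\<^sup>2)" for n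
  proof -
    have "(\<Sum>k\<le>n. a k)\<^sup>2 = (\<Sum>k\<le>n. (sqrt (h k) * a k) * (1 / sqrt (h k)))\<^sup>2"
      using h by (simp add: less_imp_neq[THEN not_sym])
    also have "\<dots> \<le> (\<Sum>k\<le>n. (sqrt (h k) * a k)\<^sup>2) * (\<Sum>k\<le>n. (1 / sqrt (h k))\<^sup>2)"
      by (rule Cauchy_Schwarz_ineq_sum)
    also have "\<dots> = (\<Sum>k\<le>n. h k * (a k)\<^sup>2) * (\<Sum>k\<le>n. 1 / h k)"
      using h less_imp_le[OF h] by (simp add: power_mult_distrib power_divide)
    also have "\<dots> \<le> (\<Sum>k\<le>n. h k * (a k)\<^sup>2) * (2 * sqrt (L n))"
      by (rule mult_left_mono[OF Lsum]) (auto intro!: sum_nonneg mult_nonneg_nonneg less_imp_le[OF h])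
    finally show ?thesis by (simp add: mult_ac)
  qed
  have "(\<Sum>n\<le>M. u n * (\<Sum>k\<le>n. a k)\<^sup>2) \<le> (\<Sum>n\<le>M. u n * (2 * sqrt (L n) * (\<Sum>k\<le>n. h k * (a k)\<^sup>2)))"
    by (intro sum_mono mult_left_mono CS u)
  \<comment> \<open>First of two uses of \<open>UL\<close>: \<open>sqrt (L n)\<close> is traded for
    \<open>sqrt A / sqrt (U n)\<close>, which \<open>Usum\<close> can sum once k is the outer index.
    The second use bounds the resulting \<open>sqrt (U k)\<close> times the
    \<open>sqrt (L k)\<close> inside \<open>h\<close> by \<open>sqrt A\<close>. \<open>Lsum\<close>
    and \<open>Usum\<close> cost a factor 2 each, hence 4 A.\<close>
  also have "\<dots> \<le> (\<Sum>n\<le>M. 2 * (sqrt A * (u n / sqrt (U n))) * (\<Sum>k\<le>n. h k * (a k)\<^sup>2))"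
  proof (rule sum_mono)
    fix n assume "n \<in> {..M}"
    have "2 * (u n * sqrt (L n)) * (\<Sum>k\<le>n. h k * (a k)\<^sup>2) \<le> 2 * (sqrt A * (u n / sqrt (U n))) * (\<Sum>k\<le>n. h k * (a k)\<^sup>2)"
      by (intro mult_right_mono mult_left_mono uL sum_nonneg)
         (use \<open>n \<in> {..M}\<close> in \<open>auto intro!: mult_nonneg_nonneg less_imp_le[OF h]\<close>)
    then show "u n * (2 * sqrt (L n) * (\<Sum>k\<le>n. h k * (a k)\<^sup>2)) \<le> 2 * (sqrt A * (u n / sqrt (U n))) * (\<Sum>k\<le>n. h k * (a k)\<^sup>2)"
      by (simp add: mult_ac)
  qed
  also have "\<dots> = (\<Sum>n\<le>M. \<Sum>k\<le>n. 2 * sqrt A * (h k * (a k)\<^sup>2) * (u n / sqrt (U n)))"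
    by (simp add: sum_distrib_left sum_divide_distrib mult_ac)
  also have "\<dots> = (\<Sum>k\<le>M. \<Sum>n=k..M. 2 * sqrt A * (h k * (a k)\<^sup>2) * (u n / sqrt (U n)))"
    unfolding sum.Sigma[OF finite_atMost ballI[OF finite_atMost]] sum.Sigma[OF finite_atMost ballI[OF finite_atLeastAtMost]]
    by (rule sum.reindex_bij_witness[of _ "\<lambda>(k,n). (n,k)" "\<lambda>(n,k). (k,n)"]) auto
  also have "\<dots> = (\<Sum>k\<le>M. 2 * sqrt A * (h k * (a k)\<^sup>2) * (\<Sum>n=k..M. u n / sqrt (U n)))"
    by (simp only: sum_distrib_left)
  also have "\<dots> \<le> (\<Sum>k\<le>M. 2 * sqrt A * (h k * (a k)\<^sup>2) * (2 * sqrt (U k)))"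
    by (intro sum_mono mult_left_mono Usum) (auto intro!: mult_nonneg_nonneg less_imp_le[OF h] A)
  also have "\<dots> = (\<Sum>k\<le>M. 4 * sqrt A * (w k * (a k)\<^sup>2) * (sqrt (U k) * sqrt (L k)))"
    by (simp add: h_def mult_ac)
  also have "\<dots> \<le> (\<Sum>k\<le>M. 4 * sqrt A * (w k * (a k)\<^sup>2) * sqrt A)"
    by (intro sum_mono mult_left_mono ULs) (auto intro!: mult_nonneg_nonneg less_imp_le[OF w] A)
  also have "\<dots> = (\<Sum>k\<le>M. 4 * A * (w k * (a k)\<^sup>2))"
  proof (intro sum.cong refl)
    fix k
    have "4 * sqrt A * (w k * (a k)\<^sup>2) * sqrt A = 4 * (sqrt A * sqrt A) * (w k * (a k)\<^sup>2)"
      by (simp only: mult_ac)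
    then show "4 * sqrt A * (w k * (a k)\<^sup>2) * sqrt A = 4 * A * (w k * (a k)\<^sup>2)"
      using A by simp
  qed
  finally show ?thesis by (simp add: sum_distrib_left)
qed

text \<open>Telescoping, since 1/(K+1)^2 <= 1/K - 1/(K+1).\<close>

lemma sum_inverse_squares_le:
  assumes "n \<ge> 1"
  shows "(\<Sum>k=Suc n..K. (1 / real k)\<^sup>2) \<le> 1 / real n"
proof -
  have "(\<Sum>k=Suc n..K. (1 / real k)\<^sup>2) \<le> 1 / real n - 1 / real K" if "n \<le> K"
    using that
  proof (induction K rule: dec_induct)
    case (step K)
    have "(1 / real (Suc K))\<^sup>2 = 1 / (real (Suc K) * real (Suc K))"
      by (simp add: power2_eq_square)
    also have "\<dots> \<le> 1 / (real K * real (Suc K))"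
      by (intro frac_le mult_right_mono) (use step assms in auto)
    also have "\<dots> = 1 / real K - 1 / real (Suc K)"
      using step assms by (simp add: field_simps)
    finally show ?case using step by simp
  qed simp
  then show ?thesis
    by (cases "n \<le> K") (auto intro: order_trans)
qed

text \<open>Cauchy-Schwarz produces the factor 1/n, which cancels the outer weight; after exchanging
  the sums each (x k)^2 is counted once for every n with 1 <= n < k, so at most k times.\<close>

lemma weighted_tail_inequality:
  fixes x :: "nat \<Rightarrow> real"
  shows "(\<Sum>n=1..M. real n * (\<Sum>k=Suc n..K. x k / real k)\<^sup>2) \<le> (\<Sum>k\<le>K. real k * (x k)\<^sup>2)"
proof -
  have "(\<Sum>n=1..M. real n * (\<Sum>k=Suc n..K. x k / real k)\<^sup>2) \<le> (\<Sum>n=1..M. \<Sum>k=Suc n..K. (x k)\<^sup>2)"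
  proof (rule sum_mono)
    fix n assume n: "n \<in> {1..M}"
    have "(\<Sum>k=Suc n..K. x k * (1 / real k))\<^sup>2 \<le> (\<Sum>k=Suc n..K. (x k)\<^sup>2) * (\<Sum>k=Suc n..K. (1 / real k)\<^sup>2)"
      by (rule Cauchy_Schwarz_ineq_sum)
    also have "\<dots> \<le> (\<Sum>k=Suc n..K. (x k)\<^sup>2) * (1 / real n)"
      by (intro mult_left_mono sum_inverse_squares_le sum_nonneg) (use n in auto)
    finally show "real n * (\<Sum>k=Suc n..K. x k / real k)\<^sup>2 \<le> (\<Sum>k=Suc n..K. (x k)\<^sup>2)"
      using n by (simp add: field_simps)
  qed
  also have "\<dots> = (\<Sum>n=1..M. \<Sum>k\<le>K. if n < k then (x k)\<^sup>2 else 0)"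
  proof (rule sum.cong[OF refl])
    fix n
    have "{Suc n..K} = {k \<in> {..K}. n < k}" by auto
    then show "(\<Sum>k=Suc n..K. (x k)\<^sup>2) = (\<Sum>k\<le>K. if n < k then (x k)\<^sup>2 else 0)"
      by (simp only: sum.inter_filter finite_atMost)
  qed
  also have "\<dots> = (\<Sum>k\<le>K. \<Sum>n=1..M. if n < k then (x k)\<^sup>2 else 0)"
    by (rule sum.swap)
  also have "\<dots> \<le> (\<Sum>k\<le>K. real k * (x k)\<^sup>2)"
  proof (rule sum_mono)
    fix k
    have "(\<Sum>n=1..M. if n < k then (x k)\<^sup>2 else 0) = real (card {n \<in> {1..M}. n < k}) * (x k)\<^sup>2"
      by (subst sum.inter_filter[symmetric]) auto
    also have "card {n \<in> {1..M}. n < k} \<le> card {..<k}"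
      by (rule card_mono) auto
    finally show "(\<Sum>n=1..M. if n < k then (x k)\<^sup>2 else 0) \<le> real k * (x k)\<^sup>2"
      by (simp add: mult_right_mono)
  qed
  finally show ?thesis .
qed

section \<open>Row tails of a truncated Hankel matrix\<close>

lemma dirichlet_weight_ge_1: "dirichlet_weight n \<ge> 1"
  by (simp add: dirichlet_weight_def)

lemma dirichlet_weight_pos: "dirichlet_weight n > 0"
  using dirichlet_weight_ge_1[of n] by linarith

lemma dirichlet_weight_ge: "dirichlet_weight n \<ge> real n"
  by (simp add: dirichlet_weight_def)

text \<open>Squaring the sum of the two parts costs a factor 2, so the Hardy constant 4 A becomes 8
  A, and the far part, with constant 1 times e^2, becomes 2 e^2. Neither constant depends on the
  truncations K and M, which makes a later limit in K possible.\<close>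

lemma hankel_finite_tail_bound:
  fixes lam \<alpha> :: "nat \<Rightarrow> real"
  assumes dec: "decseq lam" and lam: "\<And>n. lam n \<ge> 0" and \<alpha>: "\<And>k. \<alpha> k \<ge> 0"
    and N: "N \<ge> 1" and A: "A \<ge> 0" and e: "e \<ge> 0"
    and UL: "\<And>m M. m \<ge> N \<Longrightarrow> (\<Sum>n=m..M. real n * (lam n)\<^sup>2) * (\<Sum>k\<le>m. 1 / dirichlet_weight k) \<le> A"
    and le: "\<And>k. k \<ge> N \<Longrightarrow> real k * lam k \<le> e"
  shows "(\<Sum>n=N..M. real n * (\<Sum>k\<le>K. lam (n + k) * \<alpha> k)\<^sup>2)
           \<le> (8 * A + 2 * e\<^sup>2) * (\<Sum>k\<le>K. dirichlet_weight k * (\<alpha> k)\<^sup>2)"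
proof -
  \<comment> \<open>Extension by zero beyond K, because the Hardy inequality wants inner sums
    running up to n.\<close>
  define \<beta> where "\<beta> = (\<lambda>k. if k \<le> K then \<alpha> k else 0)"
  \<comment> \<open>Cut off below N: the Hardy inequality sums from 0, but \<open>UL\<close> is
    available only for m >= N.\<close>
  define u where "u = (\<lambda>n. if N \<le> n then real n * (lam n)\<^sup>2 else 0)"
  define S where "S = (\<Sum>k\<le>K. dirichlet_weight k * (\<alpha> k)\<^sup>2)"
  have split: "(\<Sum>k\<le>K. lam (n + k) * \<alpha> k) \<le> lam n * (\<Sum>k\<le>n. \<beta> k) + e * (\<Sum>k=Suc n..K. \<alpha> k / real k)"
    if n: "n \<ge> N" for n
  proof -
    have "(\<Sum>k\<le>K. lam (n + k) * \<alpha> k) = (\<Sum>k\<in>({..n} \<inter> {..K}) \<union> {Suc n..K}. lam (n + k) * \<alpha> k)"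
      by (rule sum.cong) auto
    also have "\<dots> = (\<Sum>k\<in>{..n} \<inter> {..K}. lam (n + k) * \<alpha> k) + (\<Sum>k=Suc n..K. lam (n + k) * \<alpha> k)"
      by (rule sum.union_disjoint) auto
    also have "(\<Sum>k\<in>{..n} \<inter> {..K}. lam (n + k) * \<alpha> k) \<le> (\<Sum>k\<in>{..n} \<inter> {..K}. lam n * \<alpha> k)"
      by (intro sum_mono mult_right_mono decseqD[OF dec] \<alpha>) auto
    also have "\<dots> = lam n * (\<Sum>k\<in>{..n} \<inter> {..K}. \<alpha> k)"
      by (simp only: sum_distrib_left)
    also have "(\<Sum>k\<in>{..n} \<inter> {..K}. \<alpha> k) = (\<Sum>k\<le>n. \<beta> k)"
      by (rule sum.mono_neutral_cong_left) (auto simp: \<beta>_def)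
    also have "(\<Sum>k=Suc n..K. lam (n + k) * \<alpha> k) \<le> (\<Sum>k=Suc n..K. e * (\<alpha> k / real k))"
    proof (rule sum_mono)
      fix k assume k: "k \<in> {Suc n..K}"
      have "lam (n + k) \<le> lam k" by (rule decseqD[OF dec]) simp
      also have "lam k \<le> e / real k" using le[of k] k n N by (simp add: field_simps)
      finally show "lam (n + k) * \<alpha> k \<le> e * (\<alpha> k / real k)"
        using mult_right_mono[OF _ \<alpha>[of k]] by fastforce
    qed
    finally show ?thesis by (simp add: sum_distrib_left)
  qed
  have pos: "0 \<le> (\<Sum>k\<le>K. lam (n + k) * \<alpha> k)" for n
    by (intro sum_nonneg mult_nonneg_nonneg lam \<alpha>)
  have "(\<Sum>n=N..M. real n * (\<Sum>k\<le>K. lam (n + k) * \<alpha> k)\<^sup>2)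
      \<le> (\<Sum>n=N..M. 2 * (u n * (\<Sum>k\<le>n. \<beta> k)\<^sup>2) + 2 * e\<^sup>2 * (real n * (\<Sum>k=Suc n..K. \<alpha> k / real k)\<^sup>2))"
  proof (rule sum_mono)
    fix n assume n: "n \<in> {N..M}"
    define x where "x = lam n * (\<Sum>k\<le>n. \<beta> k)"
    define y where "y = e * (\<Sum>k=Suc n..K. \<alpha> k / real k)"
    have "(\<Sum>k\<le>K. lam (n + k) * \<alpha> k)\<^sup>2 \<le> (x + y)\<^sup>2"
      using split[of n] pos[of n] n unfolding x_def y_def by (intro power_mono) auto
    also have "\<dots> \<le> 2 * x\<^sup>2 + 2 * y\<^sup>2"
      using sum_squares_bound[of x y] by (simp add: power2_sum)
    finally have "real n * (\<Sum>k\<le>K. lam (n + k) * \<alpha> k)\<^sup>2 \<le> real n * (2 * x\<^sup>2 + 2 * y\<^sup>2)"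
      by (rule mult_left_mono) simp
    also have "\<dots> = 2 * (u n * (\<Sum>k\<le>n. \<beta> k)\<^sup>2) + 2 * e\<^sup>2 * (real n * (\<Sum>k=Suc n..K. \<alpha> k / real k)\<^sup>2)"
      using n by (simp add: x_def y_def u_def power_mult_distrib algebra_simps)
    finally show "real n * (\<Sum>k\<le>K. lam (n + k) * \<alpha> k)\<^sup>2 \<le> 2 * (u n * (\<Sum>k\<le>n. \<beta> k)\<^sup>2) + 2 * e\<^sup>2 * (real n * (\<Sum>k=Suc n..K. \<alpha> k / real k)\<^sup>2)" .
  qed
  also have "\<dots> = 2 * (\<Sum>n=N..M. u n * (\<Sum>k\<le>n. \<beta> k)\<^sup>2) + 2 * e\<^sup>2 * (\<Sum>n=N..M. real n * (\<Sum>k=Suc n..K. \<alpha> k / real k)\<^sup>2)"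
    by (simp only: sum.distrib sum_distrib_left)
  also have "\<dots> \<le> 2 * (4 * A * S) + 2 * e\<^sup>2 * S"
  proof (intro add_mono mult_left_mono)
    have "(\<Sum>n=N..M. u n * (\<Sum>k\<le>n. \<beta> k)\<^sup>2) \<le> (\<Sum>n\<le>M. u n * (\<Sum>k\<le>n. \<beta> k)\<^sup>2)"
      by (rule sum_mono2) (auto simp: u_def)
    also have "\<dots> \<le> 4 * A * (\<Sum>k\<le>M. dirichlet_weight k * (\<beta> k)\<^sup>2)"
    proof (rule discrete_hardy_inequality[OF _ dirichlet_weight_pos A])
      show "u n \<ge> 0" for n by (simp add: u_def)
      fix m
      \<comment> \<open>For m < N the tail of \<open>u\<close> really starts at N, and enlarging m
        to N only increases the sum of reciprocal weights.\<close>
      define m' where "m' = max m N"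
      have "(\<Sum>n=m..M. u n) = (\<Sum>n=m'..M. real n * (lam n)\<^sup>2)"
        by (rule sum.mono_neutral_cong_right) (auto simp: u_def m'_def)
      moreover have "(\<Sum>k\<le>m. 1 / dirichlet_weight k) \<le> (\<Sum>k\<le>m'. 1 / dirichlet_weight k)"
        by (rule sum_mono2) (auto simp: m'_def less_imp_le[OF dirichlet_weight_pos])
      ultimately have "(\<Sum>n=m..M. u n) * (\<Sum>k\<le>m. 1 / dirichlet_weight k)
          \<le> (\<Sum>n=m'..M. real n * (lam n)\<^sup>2) * (\<Sum>k\<le>m'. 1 / dirichlet_weight k)"
        by (simp add: mult_left_mono sum_nonneg)
      also have "\<dots> \<le> A" by (rule UL) (simp add: m'_def)
      finally show "(\<Sum>n=m..M. u n) * (\<Sum>k\<le>m. 1 / dirichlet_weight k) \<le> A" .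
    qed
    also have "(\<Sum>k\<le>M. dirichlet_weight k * (\<beta> k)\<^sup>2) \<le> S"
    proof -
      have "(\<Sum>k\<le>M. dirichlet_weight k * (\<beta> k)\<^sup>2) = (\<Sum>k\<in>{..M} \<inter> {..K}. dirichlet_weight k * (\<alpha> k)\<^sup>2)"
        by (rule sum.mono_neutral_cong_right) (auto simp: \<beta>_def)
      also have "\<dots> \<le> S" unfolding S_def
        by (rule sum_mono2) (auto simp: less_imp_le[OF dirichlet_weight_pos])
      finally show ?thesis .
    qed
    finally show "(\<Sum>n=N..M. u n * (\<Sum>k\<le>n. \<beta> k)\<^sup>2) \<le> 4 * A * S"
      using A by (simp add: mult_left_mono)
    have "(\<Sum>n=N..M. real n * (\<Sum>k=Suc n..K. \<alpha> k / real k)\<^sup>2) \<le> (\<Sum>n=1..M. real n * (\<Sum>k=Suc n..K. \<alpha> k / real k)\<^sup>2)"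
      by (rule sum_mono2) (use N in auto)
    also have "\<dots> \<le> (\<Sum>k\<le>K. real k * (\<alpha> k)\<^sup>2)" by (rule weighted_tail_inequality)
    also have "\<dots> \<le> S" unfolding S_def
      by (intro sum_mono mult_right_mono dirichlet_weight_ge) auto
    finally show "(\<Sum>n=N..M. real n * (\<Sum>k=Suc n..K. \<alpha> k / real k)\<^sup>2) \<le> S" .
  qed auto
  finally show ?thesis by (simp add: S_def algebra_simps)
qed

section \<open>The Dirichlet space in terms of Taylor coefficients\<close>

text \<open>The squared norm on the coefficient side, real-valued for the sake of estimates and
  therefore meaningful only together with \<open>dirichlet_summable\<close>.\<close>

definition dirichlet_sum :: "(nat \<Rightarrow> complex) \<Rightarrow> real" where
  "dirichlet_sum a = (\<Sum>n. dirichlet_weight n * (cmod (a n))\<^sup>2)"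

definition dirichlet_summable :: "(nat \<Rightarrow> complex) \<Rightarrow> bool" where
  "dirichlet_summable a \<longleftrightarrow> summable (\<lambda>n. dirichlet_weight n * (cmod (a n))\<^sup>2)"

lemma dirichlet_term_nonneg [simp]: "dirichlet_weight n * x\<^sup>2 \<ge> 0"
  using dirichlet_weight_pos[of n] by simp

lemma dirichlet_sum_nonneg: "dirichlet_summable a \<Longrightarrow> dirichlet_sum a \<ge> 0"
  unfolding dirichlet_sum_def dirichlet_summable_def by (intro suminf_nonneg) auto

lemma dirichlet_sum_partial_le:
  assumes "dirichlet_summable a" "finite I"
  shows "(\<Sum>n\<in>I. dirichlet_weight n * (cmod (a n))\<^sup>2) \<le> dirichlet_sum a"
  using assms unfolding dirichlet_sum_def dirichlet_summable_def
  by (intro sum_le_suminf) auto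

text \<open>The two weights differ only at n = 0. This links the summability in (iii) to the
  sequence lam itself being a coefficient sequence of the Dirichlet space.\<close>

lemma dirichlet_summable_of_real_iff:
  "dirichlet_summable (\<lambda>n. complex_of_real (x n)) \<longleftrightarrow> summable (\<lambda>n. real n * (x n)\<^sup>2)"
  unfolding dirichlet_summable_def
  by (rule summable_cong, rule eventually_mono[OF eventually_gt_at_top[of 0]])
     (auto simp: dirichlet_weight_def)

lemma holomorphic_taylor_sums:
  assumes "f holomorphic_on unit_disk" "cmod z < 1"
  shows "(\<lambda>n. taylor_coeff f n * z ^ n) sums f z"
  using holomorphic_power_series[OF assms(1), of z] assms(2) by (simp add: taylor_coeff_def)

text \<open>Uniqueness of power series expansions; coefficients are read off a convergent series
  instead of from iterated derivatives.\<close>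

lemma taylor_coeff_eqI:
  assumes "\<And>z. cmod z < 1 \<Longrightarrow> (\<lambda>n. c n * z ^ n) sums f z"
  shows "taylor_coeff f n = c n"
proof -
  have "f has_fps_expansion Abs_fps c"
  proof (rule has_fps_expansionI)
    have "\<forall>\<^sub>F u in nhds (0::complex). u \<in> ball 0 1"
      by (rule eventually_nhds_in_open) auto
    then show "\<forall>\<^sub>F u in nhds 0. (\<lambda>n. fps_nth (Abs_fps c) n * u ^ n) sums f u"
      by eventually_elim (use assms in auto)
  qed
  from fps_nth_fps_expansion[OF this, of n] show ?thesis
    by (simp add: taylor_coeff_def)
qed

lemma taylor_coeff_lincomb:
  assumes "f holomorphic_on unit_disk" "g holomorphic_on unit_disk"
  shows "taylor_coeff (\<lambda>z. a * f z + b * g z) n = a * taylor_coeff f n + b * taylor_coeff g n"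
proof (rule taylor_coeff_eqI)
  fix z :: complex assume "cmod z < 1"
  then have "(\<lambda>n. a * (taylor_coeff f n * z ^ n) + b * (taylor_coeff g n * z ^ n)) sums (a * f z + b * g z)"
    by (intro sums_add sums_mult holomorphic_taylor_sums assms)
  then show "(\<lambda>n. (a * taylor_coeff f n + b * taylor_coeff g n) * z ^ n) sums (a * f z + b * g z)"
    by (simp add: algebra_simps)
qed

lemma dirichlet_space_iff:
  "f \<in> dirichlet_space \<longleftrightarrow> f holomorphic_on unit_disk \<and> dirichlet_summable (taylor_coeff f)"
proof (cases "f holomorphic_on unit_disk")
  case True
  have "dirichlet_sqnorm f < \<infinity> \<longleftrightarrow> dirichlet_summable (taylor_coeff f)"
    unfolding dirichlet_sqnorm_eq_suminf[OF True] dirichlet_summable_def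
  proof
    assume "(\<Sum>n. ennreal (dirichlet_weight n * (cmod (taylor_coeff f n))\<^sup>2)) < \<infinity>"
    then show "summable (\<lambda>n. dirichlet_weight n * (cmod (taylor_coeff f n))\<^sup>2)"
      by (intro summable_suminf_not_top) auto
  next
    assume "summable (\<lambda>n. dirichlet_weight n * (cmod (taylor_coeff f n))\<^sup>2)"
    then show "(\<Sum>n. ennreal (dirichlet_weight n * (cmod (taylor_coeff f n))\<^sup>2)) < \<infinity>"
      by (simp add: suminf_ennreal2)
  qed
  then show ?thesis using True by (simp add: dirichlet_space_def)
qed (simp add: dirichlet_space_def)

lemma dirichlet_norm_eq:
  assumes "f \<in> dirichlet_space"
  shows "dirichlet_norm f = ennreal (sqrt (dirichlet_sum (taylor_coeff f)))"
proof -
  have h: "f holomorphic_on unit_disk" and s: "dirichlet_summable (taylor_coeff f)"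
    using assms dirichlet_space_iff by auto
  have "dirichlet_sqnorm f = ennreal (dirichlet_sum (taylor_coeff f))"
    unfolding dirichlet_sqnorm_eq_suminf[OF h] dirichlet_sum_def
    using s by (intro suminf_ennreal2) (auto simp: dirichlet_summable_def)
  then show ?thesis using assms s by (simp add: dirichlet_norm_def dirichlet_sum_nonneg)
qed

section \<open>Functions with bounded coefficients, and norm convergence of coefficient
  sequences\<close>

lemma power_series_bounded_coeff:
  assumes "\<And>n. cmod (c n) \<le> B" "cmod z < 1"
  shows "summable (\<lambda>n. c n * z ^ n)"
proof (rule summable_comparison_test'[where N = 0])
  show "summable (\<lambda>n. B * cmod z ^ n)"
    using assms(2) by (intro summable_mult summable_geometric) auto
  show "cmod (c n * z ^ n) \<le> B * cmod z ^ n" for n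
    using assms(1) by (simp add: norm_mult norm_power mult_right_mono)
qed

lemma power_series_bounded_coeff_holomorphic:
  assumes "\<And>n. cmod (c n) \<le> B"
  shows "(\<lambda>z. \<Sum>n. c n * z ^ n) holomorphic_on unit_disk"
    and "taylor_coeff (\<lambda>z. \<Sum>n. c n * z ^ n) = c"
proof -
  have s: "(\<lambda>n. c n * z ^ n) sums (\<Sum>n. c n * z ^ n)" if "cmod z < 1" for z
    using power_series_bounded_coeff[OF assms that] by (rule summable_sums)
  show "(\<lambda>z. \<Sum>n. c n * z ^ n) holomorphic_on unit_disk"
    by (rule power_series_holomorphic[where a = c]) (use s in auto)
  show "taylor_coeff (\<lambda>z. \<Sum>n. c n * z ^ n) = c"
    using taylor_coeff_eqI[OF s] by auto
qed

lemma taylor_coeff_hankel: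
  assumes "hankel_well_defined lam f"
  shows "taylor_coeff (hankel lam f) n = hankel_coeff lam f n"
proof (rule taylor_coeff_eqI)
  fix z :: complex assume "cmod z < 1"
  then show "(\<lambda>n. hankel_coeff lam f n * z ^ n) sums hankel lam f z"
    using assms unfolding hankel_well_defined_def hankel_def by (intro summable_sums) auto
qed

text \<open>The finite sums over \<open>{N..M}\<close> pass to the limit, so g inherits the tail
  bounds that hold uniformly in n; below N only finitely many coordinates remain, and these converge
  one by one.\<close>

lemma weighted_l2_dist_tendsto_zero:
  fixes b :: "nat \<Rightarrow> nat \<Rightarrow> complex"
  assumes tail: "\<And>e. e > 0 \<Longrightarrow> \<exists>N. \<forall>n M. (\<Sum>m=N..M. dirichlet_weight m * (cmod (b n m))\<^sup>2) \<le> e"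
    and lim: "\<And>m. (\<lambda>n. b n m) \<longlonglongrightarrow> g m"
  shows "dirichlet_summable g" and "dirichlet_summable (\<lambda>m. b n m - g m)"
    and "(\<lambda>n. dirichlet_sum (\<lambda>m. b n m - g m)) \<longlonglongrightarrow> 0"
proof -
  have gtail: "(\<Sum>m=N..M. dirichlet_weight m * (cmod (g m))\<^sup>2) \<le> e"
    if "\<forall>n M. (\<Sum>m=N..M. dirichlet_weight m * (cmod (b n m))\<^sup>2) \<le> e" for N e M
  proof (rule LIMSEQ_le_const2)
    show "(\<lambda>n. \<Sum>m=N..M. dirichlet_weight m * (cmod (b n m))\<^sup>2) \<longlonglongrightarrow> (\<Sum>m=N..M. dirichlet_weight m * (cmod (g m))\<^sup>2)"
      by (intro tendsto_intros lim)
  qed (use that in auto)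
  have sumI: "dirichlet_summable c"
    and sumle: "dirichlet_sum c \<le> (\<Sum>m<N. dirichlet_weight m * (cmod (c m))\<^sup>2) + e"
    if "\<forall>M. (\<Sum>m=N..M. dirichlet_weight m * (cmod (c m))\<^sup>2) \<le> e" for c N e
  proof -
    have le: "(\<Sum>m<M. dirichlet_weight m * (cmod (c m))\<^sup>2) \<le> (\<Sum>m<N. dirichlet_weight m * (cmod (c m))\<^sup>2) + e" for M
    proof -
      have "(\<Sum>m<M. dirichlet_weight m * (cmod (c m))\<^sup>2) \<le> (\<Sum>m\<in>{..<N} \<union> {N..M}. dirichlet_weight m * (cmod (c m))\<^sup>2)"
        by (rule sum_mono2) auto
      also have "\<dots> = (\<Sum>m<N. dirichlet_weight m * (cmod (c m))\<^sup>2) + (\<Sum>m=N..M. dirichlet_weight m * (cmod (c m))\<^sup>2)"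
        by (rule sum.union_disjoint) auto
      finally show ?thesis using that[rule_format, of M] by linarith
    qed
    show s: "dirichlet_summable c" unfolding dirichlet_summable_def
      by (rule summableI_nonneg_bounded[OF _ le]) auto
    show "dirichlet_sum c \<le> (\<Sum>m<N. dirichlet_weight m * (cmod (c m))\<^sup>2) + e"
      unfolding dirichlet_sum_def
      by (rule suminf_le_const[OF _ le]) (use s in \<open>simp add: dirichlet_summable_def\<close>)
  qed
  \<comment> \<open>From |b - g|^2 <= 2 |b|^2 + 2 |g|^2 with both tails at most e. The factor 4 is
    the reason for the choice r / 8 below.\<close>
  have dtail: "(\<Sum>m=N..M. dirichlet_weight m * (cmod (b n m - g m))\<^sup>2) \<le> 4 * e"
    if *: "\<forall>n M. (\<Sum>m=N..M. dirichlet_weight m * (cmod (b n m))\<^sup>2) \<le> e" for N e n M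
  proof -
    have "(\<Sum>m=N..M. dirichlet_weight m * (cmod (b n m - g m))\<^sup>2)
      \<le> (\<Sum>m=N..M. 2 * (dirichlet_weight m * (cmod (b n m))\<^sup>2) + 2 * (dirichlet_weight m * (cmod (g m))\<^sup>2))"
    proof (rule sum_mono)
      fix m
      have "(cmod (b n m - g m))\<^sup>2 \<le> (cmod (b n m) + cmod (g m))\<^sup>2"
        by (intro power_mono norm_triangle_ineq4) auto
      also have "\<dots> \<le> 2 * (cmod (b n m))\<^sup>2 + 2 * (cmod (g m))\<^sup>2"
        using sum_squares_bound[of "cmod (b n m)" "cmod (g m)"] by (simp add: power2_sum)
      finally show "dirichlet_weight m * (cmod (b n m - g m))\<^sup>2 \<le> 2 * (dirichlet_weight m * (cmod (b n m))\<^sup>2) + 2 * (dirichlet_weight m * (cmod (g m))\<^sup>2)"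
        using mult_left_mono[OF _ less_imp_le[OF dirichlet_weight_pos[of m]]] by (fastforce simp: algebra_simps)
    qed
    also have "\<dots> = 2 * (\<Sum>m=N..M. dirichlet_weight m * (cmod (b n m))\<^sup>2) + 2 * (\<Sum>m=N..M. dirichlet_weight m * (cmod (g m))\<^sup>2)"
      by (simp only: sum.distrib sum_distrib_left)
    also have "\<dots> \<le> 4 * e" using *[rule_format, of n M] gtail[OF *, of M] by linarith
    finally show ?thesis .
  qed
  obtain N1 where N1: "\<forall>n M. (\<Sum>m=N1..M. dirichlet_weight m * (cmod (b n m))\<^sup>2) \<le> 1"
    using tail[of 1] by auto
  show "dirichlet_summable g" using sumI gtail[OF N1] by blast
  show sd: "dirichlet_summable (\<lambda>m. b n m - g m)" for n
    by (rule sumI) (use dtail[OF N1] in blast)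
  show "(\<lambda>n. dirichlet_sum (\<lambda>m. b n m - g m)) \<longlonglongrightarrow> 0"
  proof (rule LIMSEQ_I)
    fix r :: real assume r: "r > 0"
    obtain N where N: "\<forall>n M. (\<Sum>m=N..M. dirichlet_weight m * (cmod (b n m))\<^sup>2) \<le> r / 8"
      using tail[of "r / 8"] r by auto
    have "(\<lambda>n. \<Sum>m<N. dirichlet_weight m * (cmod (b n m - g m))\<^sup>2) \<longlonglongrightarrow> (\<Sum>m<N. dirichlet_weight m * (cmod (g m - g m))\<^sup>2)"
      by (intro tendsto_intros lim)
    then have "(\<lambda>n. \<Sum>m<N. dirichlet_weight m * (cmod (b n m - g m))\<^sup>2) \<longlonglongrightarrow> 0" by simp
    from order_tendstoD(2)[OF this, of "r / 2"] r
    obtain n0 where n0: "\<And>n. n \<ge> n0 \<Longrightarrow> (\<Sum>m<N. dirichlet_weight m * (cmod (b n m - g m))\<^sup>2) < r / 2"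
      by (auto simp: eventually_sequentially)
    show "\<exists>n0. \<forall>n\<ge>n0. norm (dirichlet_sum (\<lambda>m. b n m - g m) - 0) < r"
    proof (intro exI allI impI)
      fix n assume "n \<ge> n0"
      have "dirichlet_sum (\<lambda>m. b n m - g m) \<le> (\<Sum>m<N. dirichlet_weight m * (cmod (b n m - g m))\<^sup>2) + 4 * (r / 8)"
        by (rule sumle) (use dtail[OF N] in blast)
      also have "\<dots> < r" using n0[OF \<open>n \<ge> n0\<close>] by linarith
      finally show "norm (dirichlet_sum (\<lambda>m. b n m - g m) - 0) < r"
        using dirichlet_sum_nonneg[OF sd] by simp
    qed
  qed
qed

text \<open>Monotonicity replaces lam(n + k) by lam(k), and xy <= x^2 + y^2 does the rest. The bound
  is crude but uniform in n: it serves the convergence of rows and the boundedness of image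
  coefficients, not their smallness.\<close>

lemma hankel_row_summable:
  fixes a :: "nat \<Rightarrow> complex"
  assumes dec: "decseq lam" and lam: "\<And>n. lam n \<ge> 0"
    and sl: "dirichlet_summable (\<lambda>n. complex_of_real (lam n))" and sa: "dirichlet_summable a"
  shows "summable (\<lambda>k. lam (n + k) * cmod (a k))"
    and "(\<Sum>k. lam (n + k) * cmod (a k)) \<le> dirichlet_sum (\<lambda>n. complex_of_real (lam n)) + dirichlet_sum a"
proof -
  have s: "summable (\<lambda>k. dirichlet_weight k * (lam k)\<^sup>2 + dirichlet_weight k * (cmod (a k))\<^sup>2)"
    using sl sa by (intro summable_add) (auto simp: dirichlet_summable_def)
  have le: "lam (n + k) * cmod (a k) \<le> dirichlet_weight k * (lam k)\<^sup>2 + dirichlet_weight k * (cmod (a k))\<^sup>2" for k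
  proof -
    have "lam (n + k) * cmod (a k) \<le> lam k * cmod (a k)"
      by (intro mult_right_mono decseqD[OF dec]) auto
    also have "\<dots> \<le> (lam k)\<^sup>2 + (cmod (a k))\<^sup>2"
      using sum_squares_bound[of "lam k" "cmod (a k)"] lam[of k] 
        mult_nonneg_nonneg[OF lam[of k] norm_ge_zero[of "a k"]] by linarith
    also have "\<dots> \<le> dirichlet_weight k * (lam k)\<^sup>2 + dirichlet_weight k * (cmod (a k))\<^sup>2"
      using mult_right_mono[OF dirichlet_weight_ge_1[of k]] by (intro add_mono) fastforce+
    finally show ?thesis .
  qed
  show S: "summable (\<lambda>k. lam (n + k) * cmod (a k))"
    by (rule summable_comparison_test'[OF s, where N = 0]) (use le lam in \<open>simp add: abs_mult\<close>)
  have "(\<Sum>k. lam (n + k) * cmod (a k)) \<le> (\<Sum>k. dirichlet_weight k * (lam k)\<^sup>2 + dirichlet_weight k * (cmod (a k))\<^sup>2)"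
    by (rule suminf_le[OF le S s])
  also have "\<dots> = dirichlet_sum (\<lambda>n. complex_of_real (lam n)) + dirichlet_sum a"
    unfolding dirichlet_sum_def using sl sa
    by (subst suminf_add[symmetric]) (auto simp: dirichlet_summable_def)
  finally show "(\<Sum>k. lam (n + k) * cmod (a k)) \<le> dirichlet_sum (\<lambda>n. complex_of_real (lam n)) + dirichlet_sum a" .
qed

lemma hankel_row_bound:
  fixes a :: "nat \<Rightarrow> complex"
  assumes "decseq lam" and lam: "\<And>n. lam n \<ge> 0"
    and "dirichlet_summable (\<lambda>n. complex_of_real (lam n))" "dirichlet_summable a"
  shows "summable (\<lambda>k. complex_of_real (lam (n + k)) * a k)"
    and "cmod (\<Sum>k. complex_of_real (lam (n + k)) * a k) \<le> (\<Sum>k. lam (n + k) * cmod (a k))"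
proof -
  note s = hankel_row_summable(1)[OF assms, of n]
  have eq: "cmod (complex_of_real (lam (n + k)) * a k) = lam (n + k) * cmod (a k)" for k
    using lam by (simp add: norm_mult)
  show "summable (\<lambda>k. complex_of_real (lam (n + k)) * a k)"
    by (rule summable_comparison_test'[OF s, where N = 0]) (simp add: eq)
  show "cmod (\<Sum>k. complex_of_real (lam (n + k)) * a k) \<le> (\<Sum>k. lam (n + k) * cmod (a k))"
    by (rule norm_suminf_le[OF _ s]) (simp add: eq)
qed

text \<open>Limit of the truncated bound as K grows, for fixed M. On the range summed, N >= 1 makes
  \<open>dirichlet_weight n\<close> equal to n.\<close>

lemma hankel_tail_bound:
  fixes a :: "nat \<Rightarrow> complex"
  assumes dec: "decseq lam" and lam: "\<And>n. lam n \<ge> 0"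
    and sl: "dirichlet_summable (\<lambda>n. complex_of_real (lam n))" and sa: "dirichlet_summable a"
    and N: "N \<ge> 1" and A: "A \<ge> 0" and e: "e \<ge> 0"
    and UL: "\<And>m M. m \<ge> N \<Longrightarrow> (\<Sum>n=m..M. real n * (lam n)\<^sup>2) * (\<Sum>k\<le>m. 1 / dirichlet_weight k) \<le> A"
    and le: "\<And>k. k \<ge> N \<Longrightarrow> real k * lam k \<le> e"
  shows "(\<Sum>n=N..M. dirichlet_weight n * (cmod (\<Sum>k. complex_of_real (lam (n + k)) * a k))\<^sup>2)
           \<le> (8 * A + 2 * e\<^sup>2) * dirichlet_sum a"
proof -
  have "(\<Sum>n=N..M. dirichlet_weight n * (cmod (\<Sum>k. complex_of_real (lam (n + k)) * a k))\<^sup>2)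
      \<le> (\<Sum>n=N..M. real n * (\<Sum>k. lam (n + k) * cmod (a k))\<^sup>2)"
    by (intro sum_mono mult_mono power_mono hankel_row_bound[OF dec lam sl sa])
       (use N in \<open>auto simp: dirichlet_weight_def\<close>)
  also have "\<dots> \<le> (8 * A + 2 * e\<^sup>2) * dirichlet_sum a"
  proof (rule LIMSEQ_le_const2)
    show "(\<lambda>K. \<Sum>n=N..M. real n * (\<Sum>k\<le>K. lam (n + k) * cmod (a k))\<^sup>2)
       \<longlonglongrightarrow> (\<Sum>n=N..M. real n * (\<Sum>k. lam (n + k) * cmod (a k))\<^sup>2)"
      by (intro tendsto_intros summable_LIMSEQ' hankel_row_summable(1)[OF dec lam sl sa])
    have "(\<Sum>n=N..M. real n * (\<Sum>k\<le>K. lam (n + k) * cmod (a k))\<^sup>2) \<le> (8 * A + 2 * e\<^sup>2) * dirichlet_sum a" for K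
    proof -
      have "(\<Sum>n=N..M. real n * (\<Sum>k\<le>K. lam (n + k) * cmod (a k))\<^sup>2)
          \<le> (8 * A + 2 * e\<^sup>2) * (\<Sum>k\<le>K. dirichlet_weight k * (cmod (a k))\<^sup>2)"
        by (rule hankel_finite_tail_bound) (use dec lam N A e UL le in auto)
      also have "\<dots> \<le> (8 * A + 2 * e\<^sup>2) * dirichlet_sum a"
        by (intro mult_left_mono dirichlet_sum_partial_le sa) (use A in auto)
      finally show ?thesis .
    qed
    then show "\<exists>K0. \<forall>K\<ge>K0. (\<Sum>n=N..M. real n * (\<Sum>k\<le>K. lam (n + k) * cmod (a k))\<^sup>2) \<le> (8 * A + 2 * e\<^sup>2) * dirichlet_sum a"
      by blast
  qed
  finally show ?thesis .
qed

section \<open>Compactness from the tail condition\<close>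

lemma sum_inverse_dirichlet_weight_le:
  assumes "m \<ge> 1"
  shows "(\<Sum>k\<le>m. 1 / dirichlet_weight k) \<le> 4 * ln (real (m + 2))"
proof -
  \<comment> \<open>The 2 comes from k = 0 and k = 1; it is absorbed afterwards because 3 ln 2 >=
    2.\<close>
  have "(\<Sum>k\<le>m. 1 / dirichlet_weight k) \<le> 2 + ln (real m)"
    using assms
  proof (induction m rule: dec_induct)
    case base
    show ?case by (simp add: dirichlet_weight_def)
  next
    case (step m)
    have "ln (real m / real (Suc m)) \<le> real m / real (Suc m) - 1"
      by (rule ln_le_minus_one) (use step in auto)
    also have "\<dots> = - (1 / real (Suc m))" by (simp add: field_simps)
    finally have "1 / real (Suc m) \<le> ln (real (Suc m)) - ln (real m)"
      using step by (simp add: ln_div)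
    then show ?case using step by (simp add: dirichlet_weight_def)
  qed
  also have "ln (real m) \<le> ln (real (m + 2))" using assms by simp
  also have "2 \<le> 3 * ln (real (m + 2))"
  proof -
    have "ln 2 \<le> ln (real (m + 2))" by simp
    then show ?thesis using ln2_ge_two_thirds by linarith
  qed
  finally show ?thesis by simp
qed

text \<open>Condition (iii). Summability is a separate conjunct because \<open>suminf\<close> has an
  unspecified value on divergent series.\<close>

definition log_small_tail :: "(nat \<Rightarrow> real) \<Rightarrow> bool" where
  "log_small_tail lam \<longleftrightarrow> summable (\<lambda>n. real n * (lam n)\<^sup>2) \<and>
     (\<lambda>m. \<Sum>n. real (m + n) * (lam (m + n))\<^sup>2) \<in> o(\<lambda>m. 1 / ln (real (m + 2)))"

lemma partial_sum_le_tail: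
  assumes "summable (\<lambda>n. real n * (lam n)\<^sup>2)"
  shows "(\<Sum>n=m..M. real n * (lam n)\<^sup>2) \<le> (\<Sum>n. real (m + n) * (lam (m + n))\<^sup>2)"
proof -
  have "(\<Sum>n=m..M. real n * (lam n)\<^sup>2) \<le> (\<Sum>n\<in>(\<lambda>n. m + n) ` {..M}. real n * (lam n)\<^sup>2)"
  proof (rule sum_mono2)
    show "{m..M} \<subseteq> (+) m ` {..M}"
    proof
      fix n assume "n \<in> {m..M}"
      then show "n \<in> (+) m ` {..M}" by (intro image_eqI[of _ _ "n - m"]) auto
    qed
  qed auto
  also have "\<dots> = (\<Sum>n\<le>M. real (m + n) * (lam (m + n))\<^sup>2)"
    by (subst sum.reindex) auto
  also have "\<dots> \<le> (\<Sum>n. real (m + n) * (lam (m + n))\<^sup>2)"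
    using summable_ignore_initial_segment[OF assms, of m]
    by (intro sum_le_suminf) (auto simp: add.commute)
  finally show ?thesis .
qed

text \<open>The first bound is (iii) combined with the logarithmic size of the sums of reciprocal
  weights. For the second, the block from k/2 to k has at least k/2 terms, each at least (k/2) (lam
  k)^2 by monotonicity.\<close>

lemma log_small_tail_bounds:
  assumes dec: "decseq lam" and lam: "\<And>n. lam n \<ge> 0" and tail: "log_small_tail lam" and e: "e > 0"
  obtains N where "N \<ge> 1"
    and "\<And>m M. m \<ge> N \<Longrightarrow> (\<Sum>n=m..M. real n * (lam n)\<^sup>2) * (\<Sum>k\<le>m. 1 / dirichlet_weight k) \<le> e"
    and "\<And>k. k \<ge> N \<Longrightarrow> real k * lam k \<le> e"
proof -
  define T where "T = (\<lambda>m. \<Sum>n. real (m + n) * (lam (m + n))\<^sup>2)"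
  have s: "summable (\<lambda>n. real n * (lam n)\<^sup>2)" and o: "T \<in> o(\<lambda>m. 1 / ln (real (m + 2)))"
    using tail unfolding log_small_tail_def T_def by auto
  have le_T: "(\<Sum>n=m..M. real n * (lam n)\<^sup>2) \<le> T m" for m M
    unfolding T_def by (rule partial_sum_le_tail[OF s])
  have T0: "T m \<ge> 0" for m
    by (rule order_trans[OF _ le_T[where M = m]]) (auto intro: sum_nonneg)
  \<comment> \<open>\<open>e / 4\<close> pays for the factor 4 in
    \<open>sum_inverse_dirichlet_weight_le\<close>. The other entry serves the block estimate: there
    ln (m + 2) >= ln 2 is cancelled, leaving \<open>e\<^sup>2 / 4\<close>.\<close>
  define c where "c = min (e / 4) (e\<^sup>2 / 4 * ln 2)"
  have c: "c > 0" using e by (simp add: c_def)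
  obtain N1 where N1: "\<And>m. m \<ge> N1 \<Longrightarrow> norm (T m) \<le> c * norm (1 / ln (real (m + 2)))"
    using landau_o.smallD[OF o c] by (auto simp: eventually_sequentially)
  have Tle: "T m * ln (real (m + 2)) \<le> c" if "m \<ge> N1" for m
  proof -
    have "ln (real (m + 2)) > 0" by simp
    then show ?thesis using N1[OF that] T0[of m] by (simp add: field_simps)
  qed
  \<comment> \<open>Half of any k >= N, rounded up, is still at least \<open>N1\<close>; the
    \<open>+ 1\<close> makes N positive.\<close>
  define N where "N = 2 * N1 + 1"
  show ?thesis
  proof (rule that[of N])
    show "N \<ge> 1" by (simp add: N_def)
    fix m M assume m: "m \<ge> N"
    have "(\<Sum>n=m..M. real n * (lam n)\<^sup>2) * (\<Sum>k\<le>m. 1 / dirichlet_weight k) \<le> T m * (4 * ln (real (m + 2)))"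
      by (intro mult_mono le_T sum_inverse_dirichlet_weight_le T0 sum_nonneg)
         (use m in \<open>auto simp: N_def less_imp_le[OF dirichlet_weight_pos]\<close>)
    also have "\<dots> \<le> 4 * c" using Tle[of m] m by (simp add: N_def)
    also have "\<dots> \<le> e" by (simp add: c_def)
    finally show "(\<Sum>n=m..M. real n * (lam n)\<^sup>2) * (\<Sum>k\<le>m. 1 / dirichlet_weight k) \<le> e" .
  next
    fix k assume k: "k \<ge> N"
    \<comment> \<open>Half of k rounded up: every n >= m satisfies 2 n >= k, and
      \<open>{m..k}\<close> still has \<open>k div 2 + 1\<close> elements.\<close>
    define m where "m = k - k div 2"
    have m: "m \<ge> N1" "m \<le> k" using k by (auto simp: m_def N_def)
    have "(real k * lam k)\<^sup>2 / 4 = (real k / 2) * (real k / 2 * (lam k)\<^sup>2)"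
      by (simp add: power2_eq_square)
    also have "\<dots> \<le> real (card {m..k}) * (real k / 2 * (lam k)\<^sup>2)"
      by (intro mult_right_mono) (auto simp: m_def)
    also have "\<dots> = (\<Sum>n=m..k. real k / 2 * (lam k)\<^sup>2)" by simp
    also have "\<dots> \<le> (\<Sum>n=m..k. real n * (lam n)\<^sup>2)"
    proof (intro sum_mono mult_mono power_mono decseqD[OF dec] lam)
      fix n assume "n \<in> {m..k}"
      then have "k \<le> 2 * n" unfolding m_def atLeastAtMost_iff by linarith
      then show "real k / 2 \<le> real n" by simp
    qed auto
    also have "\<dots> \<le> T m" by (rule le_T)
    also have "T m \<le> e\<^sup>2 / 4"
    proof -
      have "T m * ln 2 \<le> T m * ln (real (m + 2))"
        by (intro mult_left_mono T0) simp
      also have "\<dots> \<le> e\<^sup>2 / 4 * ln 2" using Tle[OF m(1)] by (simp add: c_def)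
      finally show ?thesis by simp
    qed
    finally have "(real k * lam k)\<^sup>2 \<le> e\<^sup>2" by simp
    then show "real k * lam k \<le> e" by (rule power2_le_imp_le) (use e in simp)
  qed
qed

text \<open>N depends neither on a nor on M; this uniformity over bounded sets is the input for
  compactness.\<close>

lemma hankel_tail_small:
  assumes dec: "decseq lam" and lam: "\<And>n. lam n \<ge> 0" and tail: "log_small_tail lam" and e: "e > 0"
  shows "\<exists>N. \<forall>a M. dirichlet_summable a \<longrightarrow>
     (\<Sum>n=N..M. dirichlet_weight n * (cmod (\<Sum>k. complex_of_real (lam (n + k)) * a k))\<^sup>2) \<le> e * dirichlet_sum a"
proof -
  \<comment> \<open>d <= 1 gives d^2 <= d, so 8 d + 2 d^2 <= 10 d <= e.\<close>
  define d where "d = min 1 (e / 10)"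
  have d: "d > 0" using e by (simp add: d_def)
  obtain N where N: "N \<ge> 1"
    and 1: "\<And>m M. m \<ge> N \<Longrightarrow> (\<Sum>n=m..M. real n * (lam n)\<^sup>2) * (\<Sum>k\<le>m. 1 / dirichlet_weight k) \<le> d"
    and 2: "\<And>k. k \<ge> N \<Longrightarrow> real k * lam k \<le> d"
    using log_small_tail_bounds[OF dec lam tail d] by blast
  have sl: "dirichlet_summable (\<lambda>n. complex_of_real (lam n))"
    using tail unfolding dirichlet_summable_of_real_iff log_small_tail_def by simp
  have "8 * d + 2 * d\<^sup>2 \<le> e"
  proof -
    have "d * d \<le> d * 1" using d by (intro mult_left_mono) (auto simp: d_def)
    moreover have "10 * d \<le> e" by (simp add: d_def)
    ultimately show ?thesis by (simp add: power2_eq_square)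
  qed
  then have "(8 * d + 2 * d\<^sup>2) * dirichlet_sum a \<le> e * dirichlet_sum a" if "dirichlet_summable a" for a
    using dirichlet_sum_nonneg[OF that] by (rule mult_right_mono)
  moreover have "(\<Sum>n=N..M. dirichlet_weight n * (cmod (\<Sum>k. complex_of_real (lam (n + k)) * a k))\<^sup>2) \<le> (8 * d + 2 * d\<^sup>2) * dirichlet_sum a"
    if "dirichlet_summable a" for a M
    by (rule hankel_tail_bound[OF dec lam sl that N]) (use d 1 2 in auto)
  ultimately show ?thesis by (meson order_trans)
qed

lemma hankel_compact_if_log_small_tail:
  assumes dec: "decseq lam" and lam: "\<And>n. lam n \<ge> 0" and tail: "log_small_tail lam"
  shows "hankel_compact lam"
proof -
  have sl: "dirichlet_summable (\<lambda>n. complex_of_real (lam n))"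
    using tail unfolding dirichlet_summable_of_real_iff log_small_tail_def by simp
  define Q where "Q = dirichlet_sum (\<lambda>n. complex_of_real (lam n))"
  have D: "f holomorphic_on unit_disk" "dirichlet_summable (taylor_coeff f)" if "f \<in> dirichlet_space" for f
    using that dirichlet_space_iff by auto
  have bd: "cmod (hankel_coeff lam f n) \<le> Q + dirichlet_sum (taylor_coeff f)" if "f \<in> dirichlet_space" for f n
    unfolding hankel_coeff_def Q_def
    using hankel_row_bound(2)[OF dec lam sl D(2)[OF that], of n]
      hankel_row_summable(2)[OF dec lam sl D(2)[OF that], of n] by linarith
  have wd: "hankel_well_defined lam f" if f: "f \<in> dirichlet_space" for f
    unfolding hankel_well_defined_def
  proof (intro conjI allI ballI)
    show "summable (\<lambda>k. complex_of_real (lam (n + k)) * taylor_coeff f k)" for n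
      by (rule hankel_row_bound(1)[OF dec lam sl D(2)[OF f]])
    show "summable (\<lambda>n. hankel_coeff lam f n * z ^ n)" if "z \<in> unit_disk" for z
      using power_series_bounded_coeff[OF bd[OF f]] that by auto
    show "hankel lam f holomorphic_on unit_disk"
      using power_series_bounded_coeff_holomorphic(1)[OF bd[OF f]]
      unfolding hankel_def[abs_def] .
  qed
  have hol: "hankel lam f holomorphic_on unit_disk" if "f \<in> dirichlet_space" for f
    using wd[OF that] by (simp add: hankel_well_defined_def)
  have tc: "taylor_coeff (hankel lam f) = hankel_coeff lam f" if "f \<in> dirichlet_space" for f
    using taylor_coeff_hankel[OF wd[OF that]] by auto
  have tail': "\<exists>N. \<forall>f M. f \<in> dirichlet_space \<longrightarrow>
     (\<Sum>n=N..M. dirichlet_weight n * (cmod (hankel_coeff lam f n))\<^sup>2) \<le> e * dirichlet_sum (taylor_coeff f)" if "e > 0" for e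
    using hankel_tail_small[OF dec lam tail that] D(2) unfolding hankel_coeff_def by blast
  have maps: "hankel lam f \<in> dirichlet_space" if f: "f \<in> dirichlet_space" for f
    unfolding dirichlet_space_iff tc[OF f]
  proof (intro conjI hol f)
    show "dirichlet_summable (hankel_coeff lam f)"
    \<comment> \<open>A constant sequence converges to itself, so arbitrarily small tails already
      give summability.\<close>
    proof (rule weighted_l2_dist_tendsto_zero(1)[where b = "\<lambda>n. hankel_coeff lam f"])
      fix e :: real assume e: "e > 0"
      \<comment> \<open>The \<open>+ 1\<close> keeps the quotient meaningful when f has norm
        zero.\<close>
      define d where "d = e / (dirichlet_sum (taylor_coeff f) + 1)"
      have S0: "dirichlet_sum (taylor_coeff f) \<ge> 0" by (rule dirichlet_sum_nonneg[OF D(2)[OF f]])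
      have d: "d > 0" "d * dirichlet_sum (taylor_coeff f) \<le> e"
        using S0 e by (auto simp: d_def field_simps)
      show "\<exists>N. \<forall>n::nat. \<forall>M. (\<Sum>m=N..M. dirichlet_weight m * (cmod (hankel_coeff lam f m))\<^sup>2) \<le> e"
        using tail'[OF d(1)] f d(2) by (meson order_trans)
    qed auto
  qed
  have lin: "linear_on_dirichlet (hankel lam)"
  proof -
    \<comment> \<open>Covers both clauses of linearity: a = b = 1 for additivity, and g = f with b =
      0 for scaling.\<close>
    have lc: "hankel lam (\<lambda>u. a * f u + b * g u) z = a * hankel lam f z + b * hankel lam g z"
      if f: "f \<in> dirichlet_space" and g: "g \<in> dirichlet_space" and z: "z \<in> unit_disk" for a b f g z
    proof -
      have "hankel_coeff lam (\<lambda>u. a * f u + b * g u) n = a * hankel_coeff lam f n + b * hankel_coeff lam g n" for n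
      proof -
        have "hankel_coeff lam (\<lambda>u. a * f u + b * g u) n
            = (\<Sum>k. a * (complex_of_real (lam (n + k)) * taylor_coeff f k) + b * (complex_of_real (lam (n + k)) * taylor_coeff g k))"
          unfolding hankel_coeff_def taylor_coeff_lincomb[OF D(1)[OF f] D(1)[OF g]]
          by (simp add: algebra_simps)
        also have "\<dots> = a * hankel_coeff lam f n + b * hankel_coeff lam g n"
          using wd[OF f] wd[OF g] unfolding hankel_well_defined_def hankel_coeff_def
          by (subst suminf_add[symmetric]) (auto simp: suminf_mult summable_mult)
        finally show ?thesis .
      qed
      then have "hankel lam (\<lambda>u. a * f u + b * g u) z = (\<Sum>n. a * (hankel_coeff lam f n * z ^ n) + b * (hankel_coeff lam g n * z ^ n))"
        unfolding hankel_def by (simp add: algebra_simps)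
      also have "\<dots> = a * hankel lam f z + b * hankel lam g z"
        using wd[OF f] wd[OF g] z unfolding hankel_well_defined_def hankel_def
        by (subst suminf_add[symmetric]) (auto simp: suminf_mult summable_mult)
      finally show ?thesis .
    qed
    show ?thesis
      unfolding linear_on_dirichlet_def
    proof (intro conjI ballI allI)
      fix f g z assume "f \<in> dirichlet_space" "g \<in> dirichlet_space" "z \<in> unit_disk"
      then show "hankel lam (\<lambda>u. f u + g u) z = hankel lam f z + hankel lam g z"
        using lc[of f g z 1 1] by simp
    next
      fix c f z assume "f \<in> dirichlet_space" "z \<in> unit_disk"
      then show "hankel lam (\<lambda>u. c * f u) z = c * hankel lam f z"
        using lc[of f f z c 0] by simp
    qed (rule maps)
  qed
  have compact: "\<exists>g\<in>dirichlet_space. \<exists>r :: nat \<Rightarrow> nat. strict_mono r \<and>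
           (\<lambda>n. dirichlet_norm (\<lambda>z. hankel lam (F (r n)) z - g z)) \<longlonglongrightarrow> 0"
    if F: "\<And>n. F n \<in> dirichlet_space" and C: "C < \<infinity>" "\<And>n. dirichlet_norm (F n) \<le> C" for F C
  proof -
    define S where "S = (enn2real C)\<^sup>2"
    have S: "dirichlet_sum (taylor_coeff (F n)) \<le> S" for n
    proof -
      have "ennreal (sqrt (dirichlet_sum (taylor_coeff (F n)))) \<le> ennreal (enn2real C)"
        using C(2)[of n] C(1) by (simp add: dirichlet_norm_eq[OF F])
      then have "sqrt (dirichlet_sum (taylor_coeff (F n))) \<le> enn2real C"
        by (subst (asm) ennreal_le_iff) auto
      then show ?thesis unfolding S_def by (rule sqrt_le_D)
    qed
    have S0: "S \<ge> 0" by (simp add: S_def)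
    define b where "b = (\<lambda>n. hankel_coeff lam (F n))"
    have bB: "norm (b n m) \<le> Q + S" for n m
      using bd[OF F, of n m] S[of n] unfolding b_def by linarith
    \<comment> \<open>Diagonal extraction: the coefficients are bounded by \<open>Q + S\<close> in
      both indices, so a single subsequence makes every coefficient converge.\<close>
    obtain r where r: "strict_mono r" and ex: "\<And>m. m \<in> UNIV \<Longrightarrow> \<exists>l. (\<lambda>n. b (r n) m) \<longlonglongrightarrow> l"
      using function_convergent_subsequence[OF countableI_type, of UNIV b "Q + S"] bB by blast
    define c where "c = (\<lambda>m. lim (\<lambda>n. b (r n) m))"
    have c: "(\<lambda>n. b (r n) m) \<longlonglongrightarrow> c m" for m
      using ex[of m] unfolding c_def convergent_def[symmetric] by (simp add: convergent_LIMSEQ_iff)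
    have tl: "\<exists>N. \<forall>n M. (\<Sum>m=N..M. dirichlet_weight m * (cmod (b (r n) m))\<^sup>2) \<le> e" if e: "e > 0" for e
    proof -
      define d where "d = e / (S + 1)"
      have d: "d > 0" "d * S \<le> e" using S0 e by (auto simp: d_def field_simps)
      obtain N where N: "\<And>f M. f \<in> dirichlet_space \<Longrightarrow>
          (\<Sum>n=N..M. dirichlet_weight n * (cmod (hankel_coeff lam f n))\<^sup>2) \<le> d * dirichlet_sum (taylor_coeff f)"
        using tail'[OF d(1)] by blast
      have "(\<Sum>m=N..M. dirichlet_weight m * (cmod (b (r n) m))\<^sup>2) \<le> e" for n M
      proof -
        have "(\<Sum>m=N..M. dirichlet_weight m * (cmod (b (r n) m))\<^sup>2) \<le> d * dirichlet_sum (taylor_coeff (F (r n)))"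
          unfolding b_def by (rule N[OF F])
        also have "\<dots> \<le> d * S" by (intro mult_left_mono S) (use d in auto)
        finally show ?thesis using d(2) by linarith
      qed
      then show ?thesis by blast
    qed
    note conv = weighted_l2_dist_tendsto_zero[of "\<lambda>n. b (r n)", OF tl c]
    have cB: "cmod (c m) \<le> Q + S" for m
      by (rule LIMSEQ_le_const2[OF tendsto_norm[OF c]]) (use bB in auto)
    \<comment> \<open>The limit function is rebuilt from the limiting coefficients; these obey the
      same bound and hence define a holomorphic function on the disk.\<close>
    define g where "g = (\<lambda>z. \<Sum>n. c n * z ^ n)"
    have gh: "g holomorphic_on unit_disk" and gc: "taylor_coeff g = c"
      unfolding g_def by (rule power_series_bounded_coeff_holomorphic[OF cB])+
    have g: "g \<in> dirichlet_space"
      unfolding dirichlet_space_iff gc using gh conv(1) by blast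
    have dist: "dirichlet_norm (\<lambda>z. hankel lam (F (r n)) z - g z) = ennreal (sqrt (dirichlet_sum (\<lambda>m. b (r n) m - c m)))" for n
    proof -
      have t: "taylor_coeff (\<lambda>z. hankel lam (F (r n)) z - g z) = (\<lambda>m. b (r n) m - c m)"
        using taylor_coeff_lincomb[OF hol[OF F] gh, of 1 "r n" "-1"]
        by (auto simp: tc[OF F] gc b_def)
      have "(\<lambda>z. hankel lam (F (r n)) z - g z) \<in> dirichlet_space"
        unfolding dirichlet_space_iff t
        by (intro conjI holomorphic_intros hol F gh conv(2))
      then show ?thesis by (simp add: dirichlet_norm_eq t)
    qed
    have "(\<lambda>n. sqrt (dirichlet_sum (\<lambda>m. b (r n) m - c m))) \<longlonglongrightarrow> sqrt 0"
      by (intro tendsto_intros conv(3))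
    then have "(\<lambda>n. dirichlet_norm (\<lambda>z. hankel lam (F (r n)) z - g z)) \<longlonglongrightarrow> ennreal (sqrt 0)"
      unfolding dist by (rule tendsto_ennrealI)
    then show ?thesis using g r by auto
  qed
  have "compact_on_dirichlet (hankel lam)"
    unfolding compact_on_dirichlet_def
  proof (intro conjI lin allI impI, elim conjE exE)
    fix F :: "nat \<Rightarrow> complex \<Rightarrow> complex" and C
    assume "\<forall>n. F n \<in> dirichlet_space" "C < \<infinity>" "\<forall>n. dirichlet_norm (F n) \<le> C"
    then show "\<exists>g\<in>dirichlet_space. \<exists>r :: nat \<Rightarrow> nat. strict_mono r \<and>
           (\<lambda>n. dirichlet_norm (\<lambda>z. hankel lam (F (r n)) z - g z)) \<longlonglongrightarrow> 0"
      by (intro compact[of F C]) auto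
  qed
  then show ?thesis using wd by (simp add: hankel_compact_def)
qed

section \<open>Testing on the reproducing kernels\<close>

text \<open>This is K_t(t), the squared norm of K_t; it tends to infinity as t increases to
  1.\<close>

definition kernel_sqnorm :: "real \<Rightarrow> real" where
  "kernel_sqnorm t = 1 - ln (1 - t\<^sup>2)"

lemma kernel_sqnorm_ge_1:
  assumes "0 \<le> t" "t < 1"
  shows "kernel_sqnorm t \<ge> 1"
  using assms by (simp add: kernel_sqnorm_def power_le_one power_less_one_iff abs_square_less_1)

lemma Re_dirichlet_kernel_diag:
  assumes "0 \<le> t" "t < 1"
  shows "Re (dirichlet_kernel (complex_of_real t) (complex_of_real t)) = kernel_sqnorm t"
proof -
  have t: "1 - t\<^sup>2 > 0" using assms by (simp add: abs_square_less_1)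
  have "1 / (1 - complex_of_real t * cnj (complex_of_real t)) = complex_of_real (1 / (1 - t\<^sup>2))"
    by (simp add: power2_eq_square)
  also have "Ln \<dots> = complex_of_real (ln (1 / (1 - t\<^sup>2)))"
    by (rule Ln_of_real) (use t in simp)
  finally show ?thesis using t by (simp add: dirichlet_kernel_def kernel_sqnorm_def ln_div)
qed

lemma dirichlet_kernel_sums:
  assumes t: "0 \<le> t" "t < 1" and z: "cmod z < 1"
  shows "(\<lambda>n. complex_of_real (t ^ n / dirichlet_weight n) * z ^ n) sums dirichlet_kernel (complex_of_real t) z"
proof -
  define u where "u = z * complex_of_real t"
  have u: "cmod u < 1"
  proof -
    have "cmod z * t \<le> cmod z * 1" using t by (intro mult_left_mono) auto
    then show ?thesis using z t by (simp add: u_def norm_mult)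
  qed
  have Re: "Re (1 - u) > 0" using complex_Re_le_cmod[of u] u by simp
  then have "1 - u \<notin> \<real>\<^sub>\<le>\<^sub>0" by (auto simp: complex_nonpos_Reals_iff)
  then have L: "Ln (1 / (1 - u)) = - Ln (1 - u)"
    using Ln_inverse[of "1 - u"] by (simp add: inverse_eq_divide)
  have "(\<lambda>n. - (- (u ^ n) / of_nat n)) sums - Ln (1 + - u)"
    using Ln_series'[of "-u"] u by (intro sums_minus) simp
  \<comment> \<open>Division by zero makes the logarithmic term vanish at n = 0, so the constant 1
    of the kernel fills exactly that place.\<close>
  then have "(\<lambda>n. (if n = 0 then 1 else 0) + u ^ n / of_nat n) sums (1 + Ln (1 / (1 - u)))"
    unfolding L using sums_single[of 0 "\<lambda>_. 1::complex"] by (intro sums_add) simp_all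
  also have "(\<lambda>n. (if n = 0 then 1 else 0) + u ^ n / of_nat n) = (\<lambda>n. complex_of_real (t ^ n / dirichlet_weight n) * z ^ n)"
    by (auto simp: dirichlet_weight_def u_def power_mult_distrib)
  finally show ?thesis by (simp add: dirichlet_kernel_def u_def)
qed

section \<open>Normalized kernels and the coefficients of their images\<close>

context
  fixes t :: real
  assumes t: "0 \<le> t" "t < 1"
begin

lemma normalized_kernel_sums:
  assumes "cmod z < 1"
  shows "(\<lambda>n. complex_of_real (t ^ n / dirichlet_weight n / sqrt (kernel_sqnorm t)) * z ^ n)
           sums normalized_dirichlet_kernel (complex_of_real t) z"
  using sums_divide[OF dirichlet_kernel_sums[OF t assms], of "complex_of_real (sqrt (kernel_sqnorm t))"]
  unfolding normalized_dirichlet_kernel_def Re_dirichlet_kernel_diag[OF t] by simp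

lemma taylor_coeff_normalized_kernel:
  "taylor_coeff (normalized_dirichlet_kernel (complex_of_real t)) n
     = complex_of_real (t ^ n / dirichlet_weight n / sqrt (kernel_sqnorm t))"
  by (rule taylor_coeff_eqI[OF normalized_kernel_sums])

lemma normalized_kernel_in_dirichlet_space:
  "normalized_dirichlet_kernel (complex_of_real t) \<in> dirichlet_space"
  and dirichlet_norm_normalized_kernel:
  "dirichlet_norm (normalized_dirichlet_kernel (complex_of_real t)) = 1"
proof -
  let ?k = "normalized_dirichlet_kernel (complex_of_real t)"
  have \<kappa>: "kernel_sqnorm t > 0" using kernel_sqnorm_ge_1[OF t] by linarith
  have "?k holomorphic_on unit_disk"
  proof (rule power_series_holomorphic)
    fix w :: complex assume "w \<in> unit_disk"
    then show "(\<lambda>n. complex_of_real (t ^ n / dirichlet_weight n / sqrt (kernel_sqnorm t)) * (w - 0) ^ n) sums ?k w"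
      using normalized_kernel_sums[of w] by simp
  qed
  moreover have "(\<lambda>n. dirichlet_weight n * (cmod (taylor_coeff ?k n))\<^sup>2) sums 1"
  proof -
    \<comment> \<open>Weight times squared coefficient of K_t is the n-th term of the kernel series
      at z = t, so the weighted sum is K_t(t) and the normalized kernel has norm 1.\<close>
    have "(\<lambda>n. Re (complex_of_real (t ^ n / dirichlet_weight n) * complex_of_real t ^ n)) sums kernel_sqnorm t"
      unfolding Re_dirichlet_kernel_diag[OF t, symmetric]
      using t by (intro sums_Re dirichlet_kernel_sums) auto
    from sums_divide[OF this, of "kernel_sqnorm t"]
    have "(\<lambda>n. Re (complex_of_real (t ^ n / dirichlet_weight n) * complex_of_real t ^ n) / kernel_sqnorm t) sums 1"
      using \<kappa> by simp
    also have "(\<lambda>n. Re (complex_of_real (t ^ n / dirichlet_weight n) * complex_of_real t ^ n) / kernel_sqnorm t)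
       = (\<lambda>n. dirichlet_weight n * (cmod (taylor_coeff ?k n))\<^sup>2)"
    proof
      fix n
      have "dirichlet_weight n * (cmod (taylor_coeff ?k n))\<^sup>2 = dirichlet_weight n * (t ^ n / dirichlet_weight n / sqrt (kernel_sqnorm t))\<^sup>2"
        unfolding taylor_coeff_normalized_kernel norm_of_real by (simp only: power2_abs)
      also have "\<dots> = t ^ n / dirichlet_weight n * t ^ n / kernel_sqnorm t"
        using \<kappa> dirichlet_weight_pos[of n] by (simp add: power_divide) (simp add: power2_eq_square)
      also have "\<dots> = Re (complex_of_real (t ^ n / dirichlet_weight n) * complex_of_real t ^ n) / kernel_sqnorm t"
        by (simp only: of_real_power[symmetric] of_real_mult[symmetric] Re_complex_of_real)
      finally show "Re (complex_of_real (t ^ n / dirichlet_weight n) * complex_of_real t ^ n) / kernel_sqnorm t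
         = dirichlet_weight n * (cmod (taylor_coeff ?k n))\<^sup>2" by simp
    qed
    finally show ?thesis .
  qed
  ultimately show k: "?k \<in> dirichlet_space" and "dirichlet_norm ?k = 1"
    by (simp_all add: dirichlet_space_iff dirichlet_norm_eq dirichlet_summable_def dirichlet_sum_def sums_iff)
qed

lemma hankel_kernel_row_summable:
  assumes dec: "decseq lam" and lam: "\<And>n. lam n \<ge> 0"
  shows "summable (\<lambda>k. lam (n + k) * (t ^ k / dirichlet_weight k))"
proof (rule summable_comparison_test'[where N = 0])
  show "summable (\<lambda>k. lam 0 * t ^ k)" using t by (intro summable_mult summable_geometric) auto
  fix k
  have "t ^ k / dirichlet_weight k \<le> t ^ k / 1"
    using t dirichlet_weight_ge_1[of k] by (intro divide_left_mono) auto
  then have "lam (n + k) * (t ^ k / dirichlet_weight k) \<le> lam 0 * t ^ k"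
    using t lam decseqD[OF dec, of 0 "n + k"] dirichlet_weight_pos[of k] by (intro mult_mono) auto
  then show "norm (lam (n + k) * (t ^ k / dirichlet_weight k)) \<le> lam 0 * t ^ k"
    using t lam[of "n + k"] dirichlet_weight_pos[of k] by (simp add: abs_mult)
qed

lemma hankel_coeff_normalized_kernel:
  assumes "decseq lam" and "\<And>n. lam n \<ge> 0"
  shows "hankel_coeff lam (normalized_dirichlet_kernel (complex_of_real t)) n
     = complex_of_real ((\<Sum>k. lam (n + k) * (t ^ k / dirichlet_weight k)) / sqrt (kernel_sqnorm t))"
proof -
  have "hankel_coeff lam (normalized_dirichlet_kernel (complex_of_real t)) n
     = (\<Sum>k. complex_of_real (lam (n + k) * (t ^ k / dirichlet_weight k) / sqrt (kernel_sqnorm t)))"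
    by (simp add: hankel_coeff_def taylor_coeff_normalized_kernel)
  also have "\<dots> = complex_of_real (\<Sum>k. lam (n + k) * (t ^ k / dirichlet_weight k) / sqrt (kernel_sqnorm t))"
    by (rule suminf_of_real[symmetric]) (intro summable_divide hankel_kernel_row_summable assms)
  also have "(\<Sum>k. lam (n + k) * (t ^ k / dirichlet_weight k) / sqrt (kernel_sqnorm t))
     = (\<Sum>k. lam (n + k) * (t ^ k / dirichlet_weight k)) / sqrt (kernel_sqnorm t)"
    by (rule suminf_divide) (intro hankel_kernel_row_summable assms)
  finally show ?thesis .
qed

end

text \<open>The point is uniformity in t, which a geometric majorant cannot give as t tends to 1.
  Instead t^k <= 1 is used, and lam k / w k <= w k (lam k)^2 + 1/(w k)^2 with w the weight; both
  right-hand terms are summable.\<close>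

lemma hankel_kernel_row_bounded:
  assumes dec: "decseq lam" and lam: "\<And>n. lam n \<ge> 0"
    and sl: "dirichlet_summable (\<lambda>n. complex_of_real (lam n))"
  shows "\<exists>B. \<forall>t n. 0 \<le> t \<longrightarrow> t < 1 \<longrightarrow> (\<Sum>k. lam (n + k) * (t ^ k / dirichlet_weight k)) \<le> B"
proof -
  have s2: "summable (\<lambda>k. (1 / dirichlet_weight k)\<^sup>2)"
  proof -
    have "summable (\<lambda>k. inverse ((real k)\<^sup>2))"
      by (rule inverse_power_summable) simp
    then show ?thesis
      by (rule summable_cong[THEN iffD1, rotated], intro eventually_mono[OF eventually_gt_at_top[of 0]])
         (auto simp: dirichlet_weight_def power_divide inverse_eq_divide)
  qed
  have s: "summable (\<lambda>k. dirichlet_weight k * (lam k)\<^sup>2 + (1 / dirichlet_weight k)\<^sup>2)"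
    using sl s2 by (intro summable_add) (auto simp: dirichlet_summable_def)
  have "(\<Sum>k. lam (n + k) * (t ^ k / dirichlet_weight k)) \<le> (\<Sum>k. dirichlet_weight k * (lam k)\<^sup>2 + (1 / dirichlet_weight k)\<^sup>2)"
    if t: "0 \<le> t" "t < 1" for t n
  proof (rule suminf_le[OF _ hankel_kernel_row_summable[OF t dec lam] s])
    fix k
    have w: "dirichlet_weight k > 0" by (rule dirichlet_weight_pos)
    have "lam (n + k) * (t ^ k / dirichlet_weight k) \<le> lam k * (1 / dirichlet_weight k)"
      using t w lam by (intro mult_mono decseqD[OF dec] divide_right_mono power_le_one) auto
    also have "\<dots> \<le> (lam k)\<^sup>2 + (1 / dirichlet_weight k)\<^sup>2"
    proof -
      have "lam k * (1 / dirichlet_weight k) \<ge> 0" using lam[of k] w by simp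
      then show ?thesis using sum_squares_bound[of "lam k" "1 / dirichlet_weight k"] by linarith
    qed
    also have "(lam k)\<^sup>2 \<le> dirichlet_weight k * (lam k)\<^sup>2"
      using mult_right_mono[OF dirichlet_weight_ge_1[of k], of "(lam k)\<^sup>2"] by simp
    finally show "lam (n + k) * (t ^ k / dirichlet_weight k) \<le> dirichlet_weight k * (lam k)\<^sup>2 + (1 / dirichlet_weight k)\<^sup>2"
      by simp
  qed
  then show ?thesis by blast
qed

text \<open>The image of the constant function 1 has the coefficients lam n and lies in the
  Dirichlet space.\<close>

lemma dirichlet_summable_if_hankel_compact:
  assumes "hankel_compact lam"
  shows "dirichlet_summable (\<lambda>n. complex_of_real (lam n))"
proof -
  let ?f = "\<lambda>z::complex. 1 :: complex"
  have tc: "taylor_coeff ?f n = (if n = 0 then 1 else 0)" for n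
  proof (rule taylor_coeff_eqI)
    fix z :: complex
    have "(\<lambda>n. if n = 0 then 1 else 0 :: complex) sums 1"
      using sums_single[of 0 "\<lambda>_. 1::complex"] by simp
    then show "(\<lambda>n. (if n = 0 then 1 else 0) * z ^ n) sums 1"
      by (rule sums_cong[THEN iffD1, rotated]) auto
  qed
  have "?f \<in> dirichlet_space"
    unfolding dirichlet_space_iff
  proof
    show "dirichlet_summable (taylor_coeff ?f)"
      unfolding dirichlet_summable_def by (rule summable_finite[of "{0}"]) (auto simp: tc)
  qed (rule holomorphic_on_const)
  then have "hankel lam ?f \<in> dirichlet_space" "hankel_well_defined lam ?f"
    using assms by (auto simp: hankel_compact_def compact_on_dirichlet_def linear_on_dirichlet_def)
  then have "dirichlet_summable (hankel_coeff lam ?f)"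
    using taylor_coeff_hankel[of lam ?f] by (simp add: dirichlet_space_iff dirichlet_summable_def)
  moreover have "hankel_coeff lam ?f n = complex_of_real (lam n)" for n
  proof -
    have "hankel_coeff lam ?f n = (\<Sum>k\<in>{0}. complex_of_real (lam (n + k)) * taylor_coeff ?f k)"
      unfolding hankel_coeff_def by (rule suminf_finite) (auto simp: tc)
    then show ?thesis by (simp add: tc)
  qed
  ultimately show ?thesis by (simp add: dirichlet_summable_def)
qed

text \<open>Otherwise the norms stay above some a > 0 along a sequence t_n tending to 1. Compactness
  gives a norm limit g along a subsequence, and its coefficients must be the coefficientwise limits,
  namely 0.\<close>

lemma hankel_kernel_tendsto_zero_if_compact:
  assumes dec: "decseq lam" and lam: "\<And>n. lam n \<ge> 0" and comp: "hankel_compact lam"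
  shows "((\<lambda>t. dirichlet_norm (hankel lam (normalized_dirichlet_kernel (complex_of_real t)))) \<longlongrightarrow> 0) (at_left (1::real))"
proof (rule ccontr)
  define K where "K = (\<lambda>t. normalized_dirichlet_kernel (complex_of_real t))"
  assume "\<not> ?thesis"
  then obtain a :: ennreal where "a > 0" and "\<not> (\<forall>\<^sub>F t in at_left 1. dirichlet_norm (hankel lam (K t)) < a)"
    unfolding K_def order_tendsto_iff by auto
  then have "\<exists>t>b. t < 1 \<and> a \<le> dirichlet_norm (hankel lam (K t))" if "b < 1" for b
    using that unfolding eventually_at_left_field by (meson not_le)
  then have "\<exists>t. 1 - 1 / real (n + 1) < t \<and> t < 1 \<and> a \<le> dirichlet_norm (hankel lam (K t))" for n
    by auto
  then obtain t where t1: "\<And>n. 1 - 1 / real (n + 1) < t n" "\<And>n. t n < 1"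
    and ta: "\<And>n. a \<le> dirichlet_norm (hankel lam (K (t n)))" by metis
  have t0: "0 \<le> t n" for n
  proof -
    have "1 / real (n + 1) \<le> 1" by simp
    then show ?thesis using t1(1)[of n] by linarith
  qed
  have "t \<longlonglongrightarrow> 1"
  proof (rule tendsto_sandwich[of "\<lambda>n. 1 - 1 / real (n + 1)" _ _ "\<lambda>_. 1"])
    show "(\<lambda>n. 1 - 1 / real (n + 1)) \<longlonglongrightarrow> 1" by real_asymp
  qed (use t1[THEN less_imp_le] in \<open>auto intro!: always_eventually\<close>)
  then have tl: "filterlim t (at_left 1) sequentially"
    using less_imp_neq[OF t1(2)] t1(2) by (simp add: filterlim_at)
  have KD: "K (t n) \<in> dirichlet_space" "dirichlet_norm (K (t n)) = 1" for n
    unfolding K_def using normalized_kernel_in_dirichlet_space dirichlet_norm_normalized_kernel t0 t1(2) by auto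
  have HD: "hankel lam (K (t n)) \<in> dirichlet_space" and wd: "hankel_well_defined lam (K (t n))" for n
    using comp KD(1) by (auto simp: hankel_compact_def compact_on_dirichlet_def linear_on_dirichlet_def)
  have c1: "\<exists>g\<in>dirichlet_space. \<exists>r :: nat \<Rightarrow> nat. strict_mono r \<and>
           (\<lambda>n. dirichlet_norm (\<lambda>z. hankel lam (F (r n)) z - g z)) \<longlonglongrightarrow> 0"
    if "\<And>n. F n \<in> dirichlet_space" "C < \<infinity>" "\<And>n. dirichlet_norm (F n) \<le> C" for F C
    using comp that unfolding hankel_compact_def compact_on_dirichlet_def by blast
  obtain g r where g: "g \<in> dirichlet_space" and r: "strict_mono (r :: nat \<Rightarrow> nat)"
    and lim: "(\<lambda>n. dirichlet_norm (\<lambda>z. hankel lam (K (t (r n))) z - g z)) \<longlonglongrightarrow> 0"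
    using c1[of "\<lambda>n. K (t n)" 1] KD by auto
  define b where "b = (\<lambda>n. hankel_coeff lam (K (t (r n))))"
  define c where "c = taylor_coeff g"
  have tcH: "taylor_coeff (hankel lam (K (t (r n)))) = b n" for n
    unfolding b_def using taylor_coeff_hankel[OF wd] by auto
  have hol: "hankel lam (K (t (r n))) holomorphic_on unit_disk" "g holomorphic_on unit_disk"
    "dirichlet_summable (b n)" for n
    using HD[of "r n"] g by (simp_all add: dirichlet_space_iff tcH)
  have tcd: "taylor_coeff (\<lambda>z. hankel lam (K (t (r n))) z - g z) = (\<lambda>m. b n m - c m)" for n
    using taylor_coeff_lincomb[OF hol(1,2), of 1 n "-1"] by (auto simp: tcH c_def)
  have "filterlim (\<lambda>n. t (r n)) (at_left 1) sequentially"
    by (rule filterlim_compose[OF tl filterlim_subseq[OF r]])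
  moreover obtain B where B: "\<And>t n. 0 \<le> t \<Longrightarrow> t < 1 \<Longrightarrow> (\<Sum>k. lam (n + k) * (t ^ k / dirichlet_weight k)) \<le> B"
    using hankel_kernel_row_bounded[OF dec lam dirichlet_summable_if_hankel_compact[OF comp]] by blast
  \<comment> \<open>The row sums are bounded by B uniformly in t, while the norm of K_t, by which
    they are divided, tends to infinity.\<close>
  moreover have "((\<lambda>t. B / sqrt (kernel_sqnorm t)) \<longlongrightarrow> 0) (at_left 1)"
    unfolding kernel_sqnorm_def by real_asymp
  ultimately have Blim: "(\<lambda>n. B / sqrt (kernel_sqnorm (t (r n)))) \<longlonglongrightarrow> 0"
    by (rule_tac filterlim_compose)
  have b0: "(\<lambda>n. b n m) \<longlonglongrightarrow> 0" for m
  proof (rule Lim_null_comparison[OF always_eventually Blim], rule allI)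
    fix n
    let ?t = "t (r n)"
    have tt: "0 \<le> ?t" "?t < 1" using t0 t1(2) by auto
    have "(\<Sum>k. lam (m + k) * (?t ^ k / dirichlet_weight k)) \<ge> 0"
      using tt lam dirichlet_weight_pos
      by (intro suminf_nonneg hankel_kernel_row_summable[OF tt dec lam]) (auto intro!: mult_nonneg_nonneg divide_nonneg_pos)
    then show "norm (b n m) \<le> B / sqrt (kernel_sqnorm ?t)"
      unfolding b_def K_def hankel_coeff_normalized_kernel[OF tt dec lam] norm_of_real
      using B[OF tt, of m] kernel_sqnorm_ge_1[OF tt] by (simp add: abs_of_nonneg divide_right_mono)
  qed
  have dD: "(\<lambda>z. hankel lam (K (t (r n))) z - g z) \<in> dirichlet_space" if "dirichlet_summable (\<lambda>m. b n m - c m)" for n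
    unfolding dirichlet_space_iff tcd by (intro conjI holomorphic_intros hol that)
  have ev: "\<forall>\<^sub>F n in sequentially. dirichlet_norm (\<lambda>z. hankel lam (K (t (r n))) z - g z) < a'" if "a' > 0" for a'
    using order_tendstoD(2)[OF lim that] .
  have c0: "c m = 0" for m
  proof (rule ccontr)
    assume "c m \<noteq> 0"
    then have e: "cmod (c m) / 2 > 0" by simp
    have "\<forall>\<^sub>F n in sequentially. cmod (b n m) < cmod (c m) / 2"
      using order_tendstoD(2)[OF tendsto_norm_zero[OF b0[of m]] e] .
    moreover have "\<forall>\<^sub>F n in sequentially. dirichlet_norm (\<lambda>z. hankel lam (K (t (r n))) z - g z) < ennreal (cmod (c m) / 2)"
      by (rule ev) (use e in simp)
    ultimately have "\<forall>\<^sub>F n in sequentially. False"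
    proof eventually_elim
      case (elim n)
      \<comment> \<open>A norm below a real number forces membership, since
        \<open>dirichlet_norm\<close> is infinite outside the space.\<close>
      have D: "(\<lambda>z. hankel lam (K (t (r n))) z - g z) \<in> dirichlet_space"
        using elim(2) by (auto simp: dirichlet_norm_def split: if_splits)
      then have s: "dirichlet_summable (\<lambda>m. b n m - c m)"
        unfolding dirichlet_space_iff tcd by simp
      have "sqrt (dirichlet_sum (\<lambda>m. b n m - c m)) < cmod (c m) / 2"
        using elim(2) unfolding dirichlet_norm_eq[OF D] tcd
        by (subst (asm) ennreal_less_iff) (auto simp: dirichlet_sum_nonneg[OF s])
      \<comment> \<open>All weights are at least 1, so the norm dominates each single
        coefficient.\<close>
      moreover have "(cmod (b n m - c m))\<^sup>2 \<le> dirichlet_sum (\<lambda>m. b n m - c m)"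
        using dirichlet_sum_partial_le[OF s, of "{m}"] mult_right_mono[OF dirichlet_weight_ge_1[of m], of "(cmod (b n m - c m))\<^sup>2"]
        by simp
      then have "cmod (b n m - c m) \<le> sqrt (dirichlet_sum (\<lambda>m. b n m - c m))"
        by (rule real_le_rsqrt)
      ultimately show False
        using elim(1) norm_triangle_ineq2[of "c m" "b n m"] by (simp add: norm_minus_commute)
    qed
    then show False by simp
  qed
  \<comment> \<open>The values of g outside the disk are arbitrary, so g is not replaced by the zero
    function; the two norms are compared through their equal coefficients.\<close>
  have "\<forall>\<^sub>F n in sequentially. False"
    using ev[OF \<open>a > 0\<close>]
  proof eventually_elim
    case (elim n)
    have "dirichlet_norm (\<lambda>z. hankel lam (K (t (r n))) z - g z) = dirichlet_norm (hankel lam (K (t (r n))))"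
      using dirichlet_norm_eq[OF dD, of n] dirichlet_norm_eq[OF HD, of "r n"] hol(3)[of n]
      unfolding tcd tcH c0 by simp
    then show False using ta[of "r n"] elim by simp
  qed
  then show False by simp
qed

section \<open>From vanishing kernel images to the tail condition\<close>

text \<open>With this \<open>t\<close>, Bernoulli gives \<open>t ^ m \<ge> 1 / 2\<close>, while the norm of the kernel stays of order \<open>ln m\<close>.\<close>

lemma hankel_kernel_coeff_lower_bound:
  assumes dec: "decseq lam" and lam: "\<And>n. lam n \<ge> 0" and m: "m \<ge> 1"
  defines "t \<equiv> 1 - 1 / (2 * real m)"
  shows "lam (n + m) * (ln (real m + 1) / 2) \<le> (\<Sum>k. lam (n + k) * (t ^ k / dirichlet_weight k))"
proof -
  have t: "0 \<le> t" "t < 1" using m by (auto simp: t_def field_simps)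
  have tm: "t ^ m \<ge> 1 / 2"
    using Bernoulli_inequality[of "- (1 / (2 * real m))" m] m by (simp add: t_def field_simps)
  \<comment> \<open>Only the terms 1 <= k <= m are kept: there lam(n + k) >= lam(n + m) and t^k >=
    t^m >= 1/2, and the harmonic sum supplies the logarithm.\<close>
  have "lam (n + m) * (ln (real m + 1) / 2) \<le> lam (n + m) * (harm m / 2)"
    using lam by (intro mult_left_mono divide_right_mono ln_le_harm) auto
  also have "\<dots> = (\<Sum>k=1..m. lam (n + m) * (1 / 2 / real k))"
    by (simp add: harm_def sum_distrib_left sum_divide_distrib inverse_eq_divide mult.commute)
  also have "\<dots> \<le> (\<Sum>k=1..m. lam (n + k) * (t ^ k / dirichlet_weight k))"
  proof (rule sum_mono)
    fix k assume k: "k \<in> {1..m}"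
    have "1 / 2 \<le> t ^ k" using tm power_decreasing[of k m t] k t by auto
    then have "1 / 2 / real k \<le> t ^ k / dirichlet_weight k"
      using k by (simp add: dirichlet_weight_def divide_right_mono del: divide_divide_eq_left)
    then show "lam (n + m) * (1 / 2 / real k) \<le> lam (n + k) * (t ^ k / dirichlet_weight k)"
      using k lam by (intro mult_mono decseqD[OF dec]) auto
  qed
  also have "\<dots> \<le> (\<Sum>k. lam (n + k) * (t ^ k / dirichlet_weight k))"
    using t lam dirichlet_weight_pos
    by (intro sum_le_suminf hankel_kernel_row_summable[OF t dec lam]) (auto intro!: mult_nonneg_nonneg divide_nonneg_pos)
  finally show ?thesis .
qed

text \<open>Keeping only n >= m gives n + m <= 2 n, so the weights n and n + m are comparable and j
  = n + m runs through the tail from 2 m. In the 8, a 4 comes from squaring the half in the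
  coefficient bound and a 2 from comparing weights; e bounds the squared norm.\<close>

lemma weighted_sum_bound_from_kernel:
  assumes dec: "decseq lam" and lam: "\<And>n. lam n \<ge> 0" and m: "m \<ge> 1" and e: "e > 0"
  defines "t \<equiv> 1 - 1 / (2 * real m)"
  assumes small: "dirichlet_norm (hankel lam (normalized_dirichlet_kernel (complex_of_real t))) < ennreal (sqrt e)"
  shows "(\<Sum>j=2*m..M. real j * (lam j)\<^sup>2) \<le> 8 * (1 + ln (2 * real m)) / (ln (real m + 1))\<^sup>2 * e"
proof -
  let ?h = "hankel lam (normalized_dirichlet_kernel (complex_of_real t))"
  have t: "0 \<le> t" "t < 1" using m by (auto simp: t_def field_simps)
  define \<kappa> where "\<kappa> = kernel_sqnorm t"
  have \<kappa>1: "\<kappa> \<ge> 1" unfolding \<kappa>_def by (rule kernel_sqnorm_ge_1[OF t])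
  have \<kappa>2: "\<kappa> \<le> 1 + ln (2 * real m)"
  proof -
    \<comment> \<open>From t^2 <= t follows 1 - t^2 >= 1 - t = 1/(2m), which bounds the kernel norm
      by a logarithm of m.\<close>
    have "t * t \<le> 1 * t" using t by (intro mult_right_mono) auto
    then have le: "1 / (2 * real m) \<le> 1 - t\<^sup>2" by (simp add: t_def power2_eq_square)
    have "ln (1 / (2 * real m)) \<le> ln (1 - t\<^sup>2)"
      using le m by (intro ln_mono) auto
    moreover have "ln (1 / (2 * real m)) = - ln (2 * real m)" using m by (simp add: ln_div)
    ultimately show ?thesis by (simp add: \<kappa>_def kernel_sqnorm_def)
  qed
  have tc: "taylor_coeff ?h = hankel_coeff lam (normalized_dirichlet_kernel (complex_of_real t))"
    using taylor_coeff_hankel[OF hankel_well_defined_kernel[OF dec lam t]] by auto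
  define l where "l = ln (real m + 1)"
  have l: "l > 0" using m by (simp add: l_def)
  have D: "?h \<in> dirichlet_space"
    using small by (auto simp: dirichlet_norm_def split: if_splits)
  then have s: "dirichlet_summable (taylor_coeff ?h)" by (simp add: dirichlet_space_iff)
  have "sqrt (dirichlet_sum (taylor_coeff ?h)) < sqrt e"
    using small unfolding dirichlet_norm_eq[OF D]
    by (subst (asm) ennreal_less_iff) (auto simp: dirichlet_sum_nonneg[OF s])
  then have S: "dirichlet_sum (taylor_coeff ?h) \<le> e" by simp
  have "(\<Sum>n=m..M. real n * (lam (n + m))\<^sup>2) * (l\<^sup>2 / (4 * \<kappa>)) = (\<Sum>n=m..M. real n * (lam (n + m) * (l / 2) / sqrt \<kappa>)\<^sup>2)"
    using \<kappa>1 by (simp add: sum_distrib_right sum_divide_distrib power_mult_distrib power_divide mult.assoc)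
  also have "\<dots> \<le> (\<Sum>n=m..M. dirichlet_weight n * (cmod (taylor_coeff ?h n))\<^sup>2)"
  proof (intro sum_mono mult_mono dirichlet_weight_ge power_mono)
    fix n
    have "lam (n + m) * (l / 2) / sqrt \<kappa> \<le> (\<Sum>k. lam (n + k) * (t ^ k / dirichlet_weight k)) / sqrt \<kappa>"
      unfolding l_def t_def using \<kappa>1 by (intro divide_right_mono hankel_kernel_coeff_lower_bound[OF dec lam m]) auto
    then show "lam (n + m) * (l / 2) / sqrt \<kappa> \<le> cmod (taylor_coeff ?h n)"
      unfolding tc hankel_coeff_normalized_kernel[OF t dec lam] norm_of_real \<kappa>_def by linarith
    show "0 \<le> lam (n + m) * (l / 2) / sqrt \<kappa>" using lam l \<kappa>1 by simp
    show "0 \<le> dirichlet_weight n" using dirichlet_weight_pos[of n] by simp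
  qed auto
  also have "\<dots> \<le> e" using dirichlet_sum_partial_le[OF s, of "{m..M}"] S by simp
  finally have main: "(\<Sum>n=m..M. real n * (lam (n + m))\<^sup>2) \<le> 4 * \<kappa> * e / l\<^sup>2"
    using \<kappa>1 l by (simp add: field_simps)
  have "(\<Sum>j=2*m..M. real j * (lam j)\<^sup>2) \<le> (\<Sum>j\<in>(\<lambda>n. n + m) ` {m..M}. real j * (lam j)\<^sup>2)"
  proof (rule sum_mono2)
    show "{2*m..M} \<subseteq> (\<lambda>n. n + m) ` {m..M}"
    proof
      fix j assume "j \<in> {2*m..M}"
      then show "j \<in> (\<lambda>n. n + m) ` {m..M}" by (intro image_eqI[of _ _ "j - m"]) auto
    qed
  qed auto
  also have "\<dots> = (\<Sum>n=m..M. real (n + m) * (lam (n + m))\<^sup>2)"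
    by (subst sum.reindex) auto
  also have "\<dots> \<le> (\<Sum>n=m..M. 2 * (real n * (lam (n + m))\<^sup>2))"
  proof (rule sum_mono)
    fix n assume "n \<in> {m..M}"
    then have "real (n + m) * (lam (n + m))\<^sup>2 \<le> (2 * real n) * (lam (n + m))\<^sup>2"
      by (intro mult_right_mono) auto
    then show "real (n + m) * (lam (n + m))\<^sup>2 \<le> 2 * (real n * (lam (n + m))\<^sup>2)" by simp
  qed
  also have "\<dots> = 2 * (\<Sum>n=m..M. real n * (lam (n + m))\<^sup>2)" by (simp only: sum_distrib_left)
  also have "\<dots> \<le> 2 * (4 * \<kappa> * e / l\<^sup>2)" using main by simp
  also have "\<dots> \<le> 2 * (4 * (1 + ln (2 * real m)) * e / l\<^sup>2)"
    using \<kappa>2 e by (intro mult_left_mono divide_right_mono mult_right_mono) auto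
  also have "\<dots> = 8 * (1 + ln (2 * real m)) / l\<^sup>2 * e" by (simp add: algebra_simps)
  finally show ?thesis by (simp only: l_def)
qed

lemma log_small_tail_if_kernel_tendsto_zero:
  assumes dec: "decseq lam" and lam: "\<And>n. lam n \<ge> 0"
    and lim: "((\<lambda>t. dirichlet_norm (hankel lam (normalized_dirichlet_kernel (complex_of_real t)))) \<longlongrightarrow> 0) (at_left (1::real))"
  shows "log_small_tail lam"
proof -
  define R where "R = (\<lambda>m. 8 * (1 + ln (2 * real m)) / (ln (real m + 1))\<^sup>2)"
  have tl: "filterlim (\<lambda>m. 1 - 1 / (2 * real m)) (at_left 1) sequentially"
    by real_asymp
  have bound: "\<forall>\<^sub>F m in sequentially. \<forall>M. (\<Sum>j=2*m..M. real j * (lam j)\<^sup>2) \<le> R m * e" if e: "e > 0" for e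
  proof -
    have "\<forall>\<^sub>F t in at_left (1::real). dirichlet_norm (hankel lam (normalized_dirichlet_kernel (complex_of_real t))) < ennreal (sqrt e)"
      using order_tendstoD(2)[OF lim, of "ennreal (sqrt e)"] e by simp
    then have "\<forall>\<^sub>F m in sequentially. dirichlet_norm (hankel lam (normalized_dirichlet_kernel (complex_of_real (1 - 1 / (2 * real m))))) < ennreal (sqrt e)"
      by (rule eventually_compose_filterlim[OF _ tl])
    then show ?thesis using eventually_ge_at_top[of 1]
      unfolding R_def by eventually_elim (use weighted_sum_bound_from_kernel[OF dec lam _ e] in blast)
  qed
  obtain m1 where m1: "\<And>M. (\<Sum>j=2*m1..M. real j * (lam j)\<^sup>2) \<le> R m1 * 1"
    using bound[of 1] by (auto simp: eventually_sequentially)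
  have s: "summable (\<lambda>n. real n * (lam n)\<^sup>2)"
  proof (rule summable_iff_shift[THEN iffD1])
    show "summable (\<lambda>n. real (n + 2*m1) * (lam (n + 2*m1))\<^sup>2)"
    proof (rule summableI_nonneg_bounded)
      fix K
      have "(\<Sum>n<K. real (n + 2*m1) * (lam (n + 2*m1))\<^sup>2) = (\<Sum>j\<in>(\<lambda>n. n + 2*m1) ` {..<K}. real j * (lam j)\<^sup>2)"
        by (subst sum.reindex) auto
      also have "\<dots> \<le> (\<Sum>j=2*m1..2*m1+K. real j * (lam j)\<^sup>2)" by (rule sum_mono2) auto
      also have "\<dots> \<le> R m1 * 1" by (rule m1)
      finally show "(\<Sum>n<K. real (n + 2*m1) * (lam (n + 2*m1))\<^sup>2) \<le> R m1 * 1" .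
    qed auto
  qed
  \<comment> \<open>The product tends to 8, the logarithms cancelling asymptotically; 16 is a
    convenient larger constant, matched by testing with c / 16.\<close>
  have R16: "\<forall>\<^sub>F m in sequentially. R m * ln (2 * real m + 3) \<le> 16"
  proof -
    have "(\<lambda>m. R m * ln (2 * real m + 3)) \<longlonglongrightarrow> 8" unfolding R_def by real_asymp
    from order_tendstoD(2)[OF this, of 16] show ?thesis by (auto elim: eventually_mono)
  qed
  \<comment> \<open>The available bounds concern tails from an even index 2 m. A general i uses m =
    \<open>i div 2\<close>, where 2 m <= i and i + 2 <= 2 m + 3, the argument of the logarithm in
    \<open>R16\<close>.\<close>
  have half: "filterlim (\<lambda>i::nat. i div 2) sequentially sequentially"
    by (rule filterlim_at_top_div_const_nat) simp
  have "(\<lambda>m. \<Sum>n. real (m + n) * (lam (m + n))\<^sup>2) \<in> o(\<lambda>m. 1 / ln (real (m + 2)))"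
  proof (rule landau_o.smallI)
    fix c :: real assume c: "c > 0"
    have "\<forall>\<^sub>F m in sequentially. (\<forall>M. (\<Sum>j=2*m..M. real j * (lam j)\<^sup>2) \<le> R m * (c / 16)) \<and> R m * ln (2 * real m + 3) \<le> 16"
      by (intro eventually_conj bound R16) (use c in simp)
    then have "\<forall>\<^sub>F i in sequentially. (\<forall>M. (\<Sum>j=2*(i div 2)..M. real j * (lam j)\<^sup>2) \<le> R (i div 2) * (c / 16))
          \<and> R (i div 2) * ln (2 * real (i div 2) + 3) \<le> 16"
      by (rule eventually_compose_filterlim[OF _ half])
    then show "\<forall>\<^sub>F i in sequentially. norm (\<Sum>n. real (i + n) * (lam (i + n))\<^sup>2) \<le> c * norm (1 / ln (real (i + 2)))"
    proof eventually_elim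
      case (elim i)
      have si: "summable (\<lambda>n. real (i + n) * (lam (i + n))\<^sup>2)"
        using summable_ignore_initial_segment[OF s, of i] by (simp add: add.commute)
      \<comment> \<open>The sign is read off the bound itself: R times c / 16 dominates a sum of
        nonnegative terms.\<close>
      have R0: "R (i div 2) \<ge> 0" 
        using elim[THEN conjunct1, rule_format, of 0] c 
        by (metis (no_types, lifting) divide_pos_pos mult_nonneg_nonneg of_nat_0_le_iff order_trans sum_nonneg zero_le_mult_iff zero_le_power2 zero_less_numeral not_le)
      have "(\<Sum>n. real (i + n) * (lam (i + n))\<^sup>2) \<le> R (i div 2) * (c / 16)"
      proof (rule suminf_le_const[OF si])
        fix K
        have "(\<Sum>n<K. real (i + n) * (lam (i + n))\<^sup>2) = (\<Sum>j\<in>(\<lambda>n. i + n) ` {..<K}. real j * (lam j)\<^sup>2)"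
          by (subst sum.reindex) auto
        also have "\<dots> \<le> (\<Sum>j=2*(i div 2)..i+K. real j * (lam j)\<^sup>2)" by (rule sum_mono2) auto
        also have "\<dots> \<le> R (i div 2) * (c / 16)" using elim by blast
        finally show "(\<Sum>n<K. real (i + n) * (lam (i + n))\<^sup>2) \<le> R (i div 2) * (c / 16)" .
      qed
      moreover have "R (i div 2) * ln (real (i + 2)) \<le> 16"
      proof -
        have "i + 2 \<le> 2 * (i div 2) + 3" by linarith
        then have "real (i + 2) \<le> 2 * real (i div 2) + 3" by linarith
        then have "ln (real (i + 2)) \<le> ln (2 * real (i div 2) + 3)" by (intro ln_mono) auto
        from mult_left_mono[OF this R0] show ?thesis using elim by linarith
      qed
      from mult_right_mono[OF this, of "c / 16"] have "R (i div 2) * (c / 16) * ln (real (i + 2)) \<le> c"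
        using c by (simp add: mult_ac)
      then have "R (i div 2) * (c / 16) \<le> c / ln (real (i + 2))"
        by (subst pos_le_divide_eq) auto
      moreover have "(\<Sum>n. real (i + n) * (lam (i + n))\<^sup>2) \<ge> 0" by (rule suminf_nonneg[OF si]) auto
      moreover have "c * norm (1 / ln (real (i + 2))) = c / ln (real (i + 2))" by simp
      ultimately show ?case unfolding real_norm_def by linarith
    qed
  qed
  with s show ?thesis unfolding log_small_tail_def by blast
qed

theorem theorem4p3:
  fixes lam :: "nat \<Rightarrow> real"
  assumes "decseq lam"
    and "\<And>n. lam n > 0"
  shows "(hankel_compact lam \<longleftrightarrow>
           ((\<lambda>t. dirichlet_norm (hankel lam (normalized_dirichlet_kernel (complex_of_real t))))
              \<longlongrightarrow> 0) (at_left (1::real))) \<and>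
         (hankel_compact lam \<longleftrightarrow>
           summable (\<lambda>n. real n * (lam n)\<^sup>2) \<and>
           (\<lambda>m. \<Sum>n. real (m + n) * (lam (m + n))\<^sup>2) \<in> o(\<lambda>m. 1 / ln (real (m + 2))))"
proof -
  have lam: "lam n \<ge> 0" for n using assms(2)[of n] by simp
  \<comment> \<open>The cycle (iii) to (i) to (ii) to (iii) yields both equivalences.\<close>
  show ?thesis
    using hankel_compact_if_log_small_tail[OF assms(1) lam]
      hankel_kernel_tendsto_zero_if_compact[OF assms(1) lam]
      log_small_tail_if_kernel_tendsto_zero[OF assms(1) lam]
    unfolding log_small_tail_def by blast
qed

end
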